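(* Let $F$ be a field of characteristic two and let $(A,\sigma)$ be a totally decomposable central simple $F$-algebra with orthogonal involution. Then $(A,\sigma)$ has a unique inseparable subalgebra if and only if either $\deg_F A\leqslant 4$ or $\sigma$ is anisotropic.
   Context: An involution $\sigma$ on a central simple $F$-algebra $A$ is an antiautomorphism of order two; here involutions are of the first kind ($\sigma|_F=\mathrm{id}$). $(A,\sigma)$ is totally decomposable if it is isomorphic (as algebra with involution) to a tensor product $\bigotimes_{i=1}^n (Q_i,\sigma_i)$ of quaternion $F$-algebras with involution. $\mathrm{Sym}(A,\sigma)=\{x\in A\mid \sigma(x)=x\}$ and $\mathrm{Sym}(A,\sigma)^+=\{x\in \mathrm{Sym}(A,\sigma)\mid x^2\in F\}$. If $\deg_FA=2^n$, an inseparable subalgebra of $(A,\sigma)$ is a $2^n$-dimensional $F$-subalgebra $S\subseteq \mathrm{Sym}(A,\sigma)^+$ such that $C_A(S)=S$ (the centralizer of $S$ in $A$ equals $S$) and $S$ is generated as an $F$-algebra by $n$ elements. The involution $\sigma$ is isotropic if $\sigma(x)x=0$ for some nonzero $x\in A$, and anisotropic otherwise. *)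

theory Defs
  imports Complex_Main
begin

definition is_F_algebra :: "('f::field \<Rightarrow> 'a::ring_1 \<Rightarrow> 'a) \<Rightarrow> bool" where
  "is_F_algebra scl \<longleftrightarrow> vector_space scl \<and>
     (\<forall>c x y. scl c (x * y) = scl c x * y \<and> scl c (x * y) = x * scl c y)"

definition scalars :: "('f::field \<Rightarrow> 'a::ring_1 \<Rightarrow> 'a) \<Rightarrow> 'a set" where
  "scalars scl = range (\<lambda>c. scl c 1)"

definition is_subalgebra :: "('f::field \<Rightarrow> 'a::ring_1 \<Rightarrow> 'a) \<Rightarrow> 'a set \<Rightarrow> bool" where
  "is_subalgebra scl S \<longleftrightarrow> 1 \<in> S \<and> (\<forall>x\<in>S. \<forall>y\<in>S. x + y \<in> S \<and> x * y \<in> S)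
     \<and> (\<forall>c. \<forall>x\<in>S. scl c x \<in> S)"

definition subalg_gen :: "('f::field \<Rightarrow> 'a::ring_1 \<Rightarrow> 'a) \<Rightarrow> 'a set \<Rightarrow> 'a set" where
  "subalg_gen scl X = \<Inter>{T. is_subalgebra scl T \<and> X \<subseteq> T}"

definition fin_dim_on :: "('f::field \<Rightarrow> 'a::ring_1 \<Rightarrow> 'a) \<Rightarrow> 'a set \<Rightarrow> bool" where
  "fin_dim_on scl C \<longleftrightarrow> (\<exists>B. finite B \<and> B \<subseteq> C \<and> module.span scl B = C)"

definition fdim :: "('f::field \<Rightarrow> 'a::ring_1 \<Rightarrow> 'a) \<Rightarrow> 'a set \<Rightarrow> nat" where
  "fdim scl C = vector_space.dim scl C"

definition is_ideal_in :: "'a::ring_1 set \<Rightarrow> 'a set \<Rightarrow> bool" where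
  "is_ideal_in C I \<longleftrightarrow> I \<subseteq> C \<and> 0 \<in> I \<and> (\<forall>a\<in>I. \<forall>b\<in>I. a + b \<in> I)
     \<and> (\<forall>x\<in>C. \<forall>a\<in>I. x * a \<in> I \<and> a * x \<in> I)"

definition simple_on :: "'a::ring_1 set \<Rightarrow> bool" where
  "simple_on C \<longleftrightarrow> (1::'a) \<noteq> 0 \<and> (\<forall>I. is_ideal_in C I \<longrightarrow> I = {0} \<or> I = C)"

definition centre_on :: "'a::ring_1 set \<Rightarrow> 'a set" where
  "centre_on C = {x\<in>C. \<forall>y\<in>C. x * y = y * x}"

definition central_simple_on :: "('f::field \<Rightarrow> 'a::ring_1 \<Rightarrow> 'a) \<Rightarrow> 'a set \<Rightarrow> bool" where
  "central_simple_on scl C \<longleftrightarrow> is_subalgebra scl C \<and> fin_dim_on scl C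
     \<and> centre_on C = scalars scl \<and> simple_on C"

definition is_quaternion_subalgebra :: "('f::field \<Rightarrow> 'a::ring_1 \<Rightarrow> 'a) \<Rightarrow> 'a set \<Rightarrow> bool" where
  "is_quaternion_subalgebra scl Q \<longleftrightarrow> central_simple_on scl Q \<and> fdim scl Q = 4"

definition is_CSA :: "('f::field \<Rightarrow> 'a::ring_1 \<Rightarrow> 'a) \<Rightarrow> bool" where
  "is_CSA scl \<longleftrightarrow> is_F_algebra scl \<and> central_simple_on scl UNIV"

definition alg_degree :: "('f::field \<Rightarrow> 'a::ring_1 \<Rightarrow> 'a) \<Rightarrow> nat" where
  "alg_degree scl = (THE d. d * d = fdim scl (UNIV::'a set))"

definition is_involution_1st :: "('f::field \<Rightarrow> 'a::ring_1 \<Rightarrow> 'a) \<Rightarrow> ('a \<Rightarrow> 'a) \<Rightarrow> bool" where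
  "is_involution_1st scl \<sigma> \<longleftrightarrow>
     (\<forall>x y. \<sigma> (x + y) = \<sigma> x + \<sigma> y) \<and> (\<forall>x y. \<sigma> (x * y) = \<sigma> y * \<sigma> x)
     \<and> (\<forall>x. \<sigma> (\<sigma> x) = x) \<and> (\<forall>c x. \<sigma> (scl c x) = scl c (\<sigma> x))"

text \<open>Alternating elements Alt(A,sigma) = {x - sigma x}.  In characteristic two an
involution of the first kind is orthogonal iff 1 is not alternating
(Knus-Merkurjev-Rost-Tignol, Prop. 2.6); we use this as the definition in
characteristic two.\<close>
definition Alt :: "('a::ring_1 \<Rightarrow> 'a) \<Rightarrow> 'a set" where
  "Alt \<sigma> = {x - \<sigma> x | x. True}"

definition is_orthogonal_char2 :: "('a::ring_1 \<Rightarrow> 'a) \<Rightarrow> bool" where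
  "is_orthogonal_char2 \<sigma> \<longleftrightarrow> (1::'a) \<notin> Alt \<sigma>"

definition Sym :: "('a::ring_1 \<Rightarrow> 'a) \<Rightarrow> 'a set" where
  "Sym \<sigma> = {x. \<sigma> x = x}"

definition Sym_plus :: "('f::field \<Rightarrow> 'a::ring_1 \<Rightarrow> 'a) \<Rightarrow> ('a \<Rightarrow> 'a) \<Rightarrow> 'a set" where
  "Sym_plus scl \<sigma> = {x\<in>Sym \<sigma>. x * x \<in> scalars scl}"

definition centralizer :: "'a::ring_1 set \<Rightarrow> 'a set" where
  "centralizer S = {x. \<forall>y\<in>S. x * y = y * x}"

definition anisotropic :: "('a::ring_1 \<Rightarrow> 'a) \<Rightarrow> bool" where
  "anisotropic \<sigma> \<longleftrightarrow> (\<forall>x. \<sigma> x * x = 0 \<longrightarrow> x = 0)"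

text \<open>Total decomposability: A is the (internal) tensor product of n pairwise
commuting sigma-stable quaternion subalgebras Q 0, ..., Q (n-1), i.e. they
generate A; sigma restricts to an involution sigma_i on each Q i, and
(A,sigma) is then isomorphic to the tensor product of the (Q i, sigma_i).\<close>
definition totally_decomposable :: "('f::field \<Rightarrow> 'a::ring_1 \<Rightarrow> 'a) \<Rightarrow> ('a \<Rightarrow> 'a) \<Rightarrow> bool" where
  "totally_decomposable scl \<sigma> \<longleftrightarrow> (\<exists>n::nat. \<exists>Q::nat \<Rightarrow> 'a set.
     (\<forall>i<n. is_quaternion_subalgebra scl (Q i) \<and> \<sigma> ` Q i \<subseteq> Q i)
     \<and> (\<forall>i<n. \<forall>j<n. i \<noteq> j \<longrightarrow> (\<forall>x\<in>Q i. \<forall>y\<in>Q j. x * y = y * x))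
     \<and> subalg_gen scl (\<Union>i<n. Q i) = UNIV)"

definition is_inseparable_subalgebra ::
  "('f::field \<Rightarrow> 'a::ring_1 \<Rightarrow> 'a) \<Rightarrow> ('a \<Rightarrow> 'a) \<Rightarrow> 'a set \<Rightarrow> bool" where
  "is_inseparable_subalgebra scl \<sigma> S \<longleftrightarrow> (\<exists>n::nat. alg_degree scl = 2 ^ n
     \<and> is_subalgebra scl S \<and> fdim scl S = 2 ^ n \<and> S \<subseteq> Sym_plus scl \<sigma>
     \<and> centralizer S = S
     \<and> (\<exists>g::nat \<Rightarrow> 'a. S = subalg_gen scl (g ` {..<n})))"

end

theory Submission
  imports Defs
begin

text \<open>
  Every factor is generated by symmetric \<open>u i\<close>, \<open>v i\<close> with \<open>u i * v i + v i * u i = u i\<close>,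
  \<open>u i\<close> square-central and \<open>v i * v i + v i\<close> central, and \<open>S = F[u 0, \<dots>, u (n - 1)]\<close> is an
  inseparable subalgebra. An inseparable subalgebra contained in \<open>S\<close> equals \<open>S\<close>, since both
  are their own centralizers.

  If \<open>\<sigma>\<close> is anisotropic, then \<open>\<sigma> x * x\<close> is never alternating for \<open>x \<noteq> 0\<close>; applied to the
  commutators of a square-central symmetric \<open>x\<close> with elements of \<open>S\<close> this puts \<open>x\<close> in the
  centralizer of \<open>S\<close>, which is \<open>S\<close>. In degree 4 the square-central alternating elements lie in
  \<open>S\<close>, and a dimension count for \<open>F[x, y]\<close> produces an invertible \<open>r\<close> in it such that \<open>r\<close> and
  \<open>x * r\<close> are both alternating, so that \<open>x\<close> is in \<open>S\<close>.

  If \<open>\<sigma>\<close> is isotropic, then \<open>S\<close> contains a nonzero \<open>s\<close> with \<open>s * s = 0\<close>. In degree at least 8,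
  conjugation by the isometry \<open>1 + s * v m * v j * v k * s\<close>, for suitable \<open>s\<close>, moves \<open>S\<close> to a
  different inseparable subalgebra.
\<close>

subsection \<open>Algebras in characteristic two\<close>

locale char2_algebra = finite_dimensional_vector_space scl Basis
  for scl :: "'f::field \<Rightarrow> 'a::ring_1 \<Rightarrow> 'a" and Basis :: "'a set" +
  assumes two_eq_0: "(1::'f) + 1 = 0"
    and scl_mult_left: "scl c (x * y) = scl c x * y"
    and scl_mult_right: "scl c (x * y) = x * scl c y"
begin

lemma add_self [simp]: "x + x = (0::'a)"
proof -
  have "x + x = scl (1 + 1) x" by (simp only: scale_left_distrib scale_one)
  then show ?thesis by (simp only: two_eq_0 scale_zero_left)
qed

lemma add_self_left [simp]: "x + (x + y) = (y::'a)"
  by (simp flip: add.assoc)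

lemma move_summand: "x + y = z \<Longrightarrow> x = z + (y::'a)"
  by (auto simp: add.assoc)

lemma uminus_eq [simp]: "- x = (x::'a)"
  by (rule minus_unique) simp

lemma diff_eq_add [simp]: "x - y = x + (y::'a)"
  by (simp add: diff_conv_add_uminus del: add_uminus_conv_diff)

lemma add_eq_0_iff_eq [simp]: "x + y = 0 \<longleftrightarrow> x = (y::'a)"
  using eq_neg_iff_add_eq_0[of x y] by simp

lemma scl_1_mult [simp]: "scl c 1 * x = scl c x"
  using scl_mult_left[of c 1 x] by simp

lemma mult_scl_1 [simp]: "x * scl c 1 = scl c x"
  using scl_mult_right[of c x 1] by simp

lemmas scl_mult = scl_mult_left[symmetric] scl_mult_right[symmetric]

section \<open>Rank and nullity of linear maps\<close>

lemma linearI: "(\<And>x y. f (x + y) = f x + f y) \<Longrightarrow> (\<And>c x. f (scl c x) = scl c (f x)) \<Longrightarrow>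
    Vector_Spaces.linear scl scl f"
  by unfold_locales auto

text \<open>A basis \<open>B\<close> of the kernel extends to a basis \<open>C\<close> of
  \<open>V\<close>; on the span of \<open>C - B\<close> the map is injective, and it has there the
  same image as on \<open>V\<close>.\<close>

lemma dim_kernel_image:
  assumes f: "Vector_Spaces.linear scl scl f" and V: "subspace V"
  shows "dim V = dim {x \<in> V. f x = 0} + dim (f ` V)"
proof -
  interpret f: Vector_Spaces.linear scl scl f by (fact f)
  interpret fp: finite_dimensional_vector_space_pair_1 scl Basis scl by unfold_locales
  let ?K = "{x \<in> V. f x = 0}"
  have K: "subspace ?K"
    using V by (auto simp: subspace_def f.add f.scale)
  obtain B where B: "B \<subseteq> ?K" "independent B" "?K \<subseteq> span B" "card B = dim ?K"
    using basis_exists by blast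
  obtain C where C: "B \<subseteq> C" "C \<subseteq> V" "independent C" "V \<subseteq> span C"
    using maximal_independent_subset_extend[of B V] B by auto
  have finC: "finite C" using C(3) finiteI_independent by blast
  let ?W = "span (C - B)"
  have W: "?W \<subseteq> V" using C(2) V by (intro span_minimal) auto
  have V_eq: "V = {x + y | x y. x \<in> ?K \<and> y \<in> ?W}"
  proof
    show "V \<subseteq> {x + y | x y. x \<in> ?K \<and> y \<in> ?W}"
    proof
      fix z assume "z \<in> V"
      then have "z \<in> span (B \<union> (C - B))" using C by (auto simp: Un_absorb1)
      then obtain x y where "z = x + y" "x \<in> span B" "y \<in> ?W"
        unfolding span_Un by blast
      moreover have "span B \<subseteq> ?K" using B(1) K by (rule span_minimal)
      ultimately show "z \<in> {x + y | x y. x \<in> ?K \<and> y \<in> ?W}" by blast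
    qed
    show "{x + y | x y. x \<in> ?K \<and> y \<in> ?W} \<subseteq> V"
      using W V by (auto intro: subspace_add)
  qed
  \<comment> \<open>The dimension formula is used to get a trivial intersection:
    \<open>dim ?K\<close> and \<open>dim ?W\<close> add up to \<open>dim V\<close> by counting basis
    vectors.\<close>
  have sum: "dim V + dim (?K \<inter> ?W) = dim ?K + dim ?W"
    using dim_sums_Int[OF K subspace_span, of "C - B"] V_eq by simp
  have "dim ?W = card C - card B"
    using dim_span_eq_card_independent[OF independent_mono[OF C(3), of "C - B"]]
      card_Diff_subset[OF finite_subset[OF C(1) finC] C(1)] by auto
  moreover have "dim V = card C"
    using C by (metis dim_unique)
  moreover have "card B \<le> card C" using C(1) finC by (rule card_mono[rotated])
  ultimately have "dim (?K \<inter> ?W) = 0" using sum B(4) by linarith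
  then have triv: "?K \<inter> ?W \<subseteq> {0}" by simp
  have "inj_on f (span ?W)"
  proof (rule inj_onI)
    fix x y assume xy: "x \<in> span ?W" "y \<in> span ?W" "f x = f y"
    then have "x - y \<in> ?W" by (metis span_diff span_span)
    moreover have "f (x - y) = 0" using xy(3) by (simp only: f.diff) simp
    ultimately have "x - y \<in> ?K \<inter> ?W" using W by blast
    then show "x = y" using triv by auto
  qed
  then have "dim (f ` ?W) = dim ?W"
    by (rule fp.dim_image_eq[OF f])
  moreover have "f ` V = f ` ?W"
  proof
    show "f ` V \<subseteq> f ` ?W"
    proof
      fix z assume "z \<in> f ` V"
      then obtain w where w: "w \<in> V" "z = f w" by blast
      have "w \<in> {x + y | x y. x \<in> ?K \<and> y \<in> ?W}" using w(1) V_eq by (rule back_subst[of "(\<in>) w"])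
      then obtain x y where "x \<in> ?K" "y \<in> ?W" "z = f (x + y)" using w(2) by blast
      then show "z \<in> f ` ?W" by (simp add: f.add)
    qed
    show "f ` ?W \<subseteq> f ` V" using W by blast
  qed
  ultimately show ?thesis using sum \<open>dim (?K \<inter> ?W) = 0\<close> by simp
qed

text \<open>Since \<open>f\<close> squares to zero on \<open>V\<close>, its image lies in its
  kernel, so the rank is at most the nullity.\<close>

lemma dim_le_twice_dim_kernel:
  assumes f: "Vector_Spaces.linear scl scl f" and V: "subspace V" and sq: "\<And>x. x \<in> V \<Longrightarrow> f x \<in> V \<and> f (f x) = 0"
  shows "dim V \<le> 2 * dim {x \<in> V. f x = 0}"
proof -
  have "dim (f ` V) \<le> dim {x \<in> V. f x = 0}"
    using sq by (intro dim_subset) auto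
  then show ?thesis using dim_kernel_image[OF f V] by simp
qed

section \<open>Adjoining one element and doubling the dimension\<close>

definition adjoin :: "'a set \<Rightarrow> 'a \<Rightarrow> 'a set" where
  "adjoin B e = {p + q * e | p q. p \<in> B \<and> q \<in> B}"

lemma adjoinI: "p \<in> B \<Longrightarrow> q \<in> B \<Longrightarrow> x = p + q * e \<Longrightarrow> x \<in> adjoin B e"
  unfolding adjoin_def by blast

lemma adjoinE:
  assumes "x \<in> adjoin B e"
  obtains p q where "p \<in> B" "q \<in> B" "x = p + q * e"
  using assms unfolding adjoin_def by blast

lemma commute_left: "x * y = y * x \<Longrightarrow> x * (y * z) = y * (x * (z::'a))"
  by (simp flip: mult.assoc)

text \<open>In characteristic two the commutator is written \<open>f * x + x * f\<close>; it is a
  derivation in \<open>x\<close>, and it kills \<open>p\<close> and \<open>q\<close>.\<close>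

lemma commutator_adjoin:
  assumes "p * f = f * (p::'a)" "q * f = f * q" "f * e + e * f = h"
  shows "f * (p + q * e) + (p + q * e) * f = q * h"
proof -
  have "f * (p + q * e) + (p + q * e) * f = q * (f * e + e * f)"
    using assms(1) commute_left[OF assms(2)] by (simp add: algebra_simps)
  then show ?thesis using assms(3) by simp
qed

lemma subspace_adjoin: "subspace B \<Longrightarrow> subspace (adjoin B e)"
  unfolding adjoin_def subspace_def
proof (safe, goal_cases)
  case 1
  then show ?case by (intro exI[of _ 0]) auto
next
  case (2 x y p p' q q')
  show ?case
    by (rule exI[of _ "p + p'"], rule exI[of _ "q + q'"]) (use 2 in \<open>auto simp: algebra_simps\<close>)
next
  case (3 c x p q)
  show ?case
    by (rule exI[of _ "scl c p"], rule exI[of _ "scl c q"])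
      (use 3 in \<open>auto simp: scale_right_distrib scl_mult_left\<close>)
qed

text \<open>The commutator with \<open>f\<close> sends \<open>p + q * e\<close> to
  \<open>q * h\<close>. As \<open>h\<close> can be cancelled, its kernel is \<open>B\<close> and its
  image \<open>B * h\<close> is as large as \<open>B\<close>; rank-nullity gives the factor
  2.\<close>

lemma dim_adjoin:
  assumes B: "subspace B" and comm: "\<And>b. b \<in> B \<Longrightarrow> b * f = f * b"
    and h: "f * e + e * f = h" and cancel: "\<And>x. x * h = 0 \<Longrightarrow> x = 0"
  shows "dim (adjoin B e) = 2 * dim B"
    and "{x \<in> adjoin B e. x * f = f * x} = B"
proof -
  let ?D = "\<lambda>x. f * x + x * f"
  have D: "?D (p + q * e) = q * h" if "p \<in> B" "q \<in> B" for p q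
    using commutator_adjoin[OF comm[OF that(1)] comm[OF that(2)] h] .
  have lin: "Vector_Spaces.linear scl scl ?D"
    by (rule linearI) (simp_all add: algebra_simps scl_mult)
  have linh: "Vector_Spaces.linear scl scl (\<lambda>x. x * h)"
    by (rule linearI) (simp_all add: algebra_simps scl_mult)
  have B_sub: "B \<subseteq> adjoin B e"
    using adjoinI[OF _ subspace_0[OF B]] by fastforce
  have ker: "{x \<in> adjoin B e. ?D x = 0} = B"
  proof
    show "{x \<in> adjoin B e. ?D x = 0} \<subseteq> B"
    proof
      fix x assume "x \<in> {x \<in> adjoin B e. ?D x = 0}"
      then obtain p q where "p \<in> B" "q \<in> B" "x = p + q * e" "?D x = 0"
        unfolding adjoin_def by blast
      moreover from this have "q = 0" using D cancel by metis
      ultimately show "x \<in> B" by simp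
    qed
    show "B \<subseteq> {x \<in> adjoin B e. ?D x = 0}" using B_sub comm by auto
  qed
  then show "{x \<in> adjoin B e. x * f = f * x} = B"
    by (simp add: eq_commute[of "f * _"])
  have "?D ` adjoin B e = (\<lambda>x. x * h) ` B"
  proof
    show "?D ` adjoin B e \<subseteq> (\<lambda>x. x * h) ` B"
    proof
      fix y assume "y \<in> ?D ` adjoin B e"
      then obtain p q where "p \<in> B" "q \<in> B" "y = ?D (p + q * e)"
        unfolding adjoin_def by blast
      then show "y \<in> (\<lambda>x. x * h) ` B" using D by blast
    qed
    show "(\<lambda>x. x * h) ` B \<subseteq> ?D ` adjoin B e"
    proof
      fix y assume "y \<in> (\<lambda>x. x * h) ` B"
      then obtain q where q: "q \<in> B" "y = q * h" by blast
      have "0 \<in> B" using B by (rule subspace_0)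
      then have "?D (0 + q * e) = y" "0 + q * e \<in> adjoin B e"
        using D q unfolding adjoin_def by blast+
      then show "y \<in> ?D ` adjoin B e" by blast
    qed
  qed
  moreover have "dim ((\<lambda>x. x * h) ` B) = dim B"
  proof -
    interpret fp: finite_dimensional_vector_space_pair_1 scl Basis scl by unfold_locales
    have "inj_on (\<lambda>x. x * h) (span B)"
    proof (rule inj_onI)
      fix x y assume "x * h = y * h"
      then have "(x + y) * h = 0" by (simp add: distrib_right)
      then have "x + y = 0" by (rule cancel)
      then show "x = y" by simp
    qed
    then show ?thesis by (rule fp.dim_image_eq[OF linh])
  qed
  ultimately show "dim (adjoin B e) = 2 * dim B"
    using dim_kernel_image[OF lin subspace_adjoin[OF B, of e]] ker by simp
qed

section \<open>Generated subalgebras and centralizers\<close>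

lemma subalgebra_subspace: "is_subalgebra scl S \<Longrightarrow> subspace S"
  unfolding is_subalgebra_def subspace_def
  by (metis scale_zero_left)

lemma subalgebra_gen: "is_subalgebra scl (subalg_gen scl X)"
  unfolding subalg_gen_def is_subalgebra_def by auto

lemma gen_superset: "X \<subseteq> subalg_gen scl X"
  unfolding subalg_gen_def by auto

lemma gen_base: "x \<in> X \<Longrightarrow> x \<in> subalg_gen scl X"
  using gen_superset by auto

lemma gen_minimal: "is_subalgebra scl T \<Longrightarrow> X \<subseteq> T \<Longrightarrow> subalg_gen scl X \<subseteq> T"
  unfolding subalg_gen_def by auto

lemma gen_mono: "X \<subseteq> Y \<Longrightarrow> subalg_gen scl X \<subseteq> subalg_gen scl Y"
  unfolding subalg_gen_def by auto

lemma subalgebraD: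
  assumes "is_subalgebra scl S"
  shows "1 \<in> S" "0 \<in> S" "\<And>x y. x \<in> S \<Longrightarrow> y \<in> S \<Longrightarrow> x + y \<in> S"
    "\<And>x y. x \<in> S \<Longrightarrow> y \<in> S \<Longrightarrow> x * y \<in> S" "\<And>c x. x \<in> S \<Longrightarrow> scl c x \<in> S"
  using assms subspace_0[OF subalgebra_subspace[OF assms]] unfolding is_subalgebra_def by auto

lemma subalgebraI:
  assumes "1 \<in> S" "\<And>x y. x \<in> S \<Longrightarrow> y \<in> S \<Longrightarrow> x + y \<in> S"
    "\<And>x y. x \<in> S \<Longrightarrow> y \<in> S \<Longrightarrow> x * y \<in> S" "\<And>c x. x \<in> S \<Longrightarrow> scl c x \<in> S"
  shows "is_subalgebra scl S"
  using assms unfolding is_subalgebra_def by auto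

lemma scalars_subset: "is_subalgebra scl S \<Longrightarrow> scalars scl \<subseteq> S"
  unfolding scalars_def is_subalgebra_def by auto

lemma subalgebra_scalars: "is_subalgebra scl (scalars scl)"
  unfolding scalars_def is_subalgebra_def
  by (auto simp: image_iff) (metis scale_one scale_left_distrib scale_scale)+

lemma subalgebra_centralizer: "is_subalgebra scl (centralizer X)"
  unfolding is_subalgebra_def centralizer_def
proof (safe, goal_cases)
  case (2 x y z)
  then show ?case by (simp add: distrib_left distrib_right)
next
  case (3 x y z)
  then show ?case by (metis mult.assoc)
next
  case (4 c x z)
  then show ?case by (simp add: scl_mult)
qed simp

text \<open>The double centralizer of \<open>X\<close> is a subalgebra containing \<open>X\<close>,
  hence contains the subalgebra generated by \<open>X\<close>.\<close>

lemma centralizer_gen: "centralizer (subalg_gen scl X) = centralizer X"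
proof
  show "centralizer (subalg_gen scl X) \<subseteq> centralizer X"
    using gen_superset[of X] unfolding centralizer_def by auto
  have "subalg_gen scl X \<subseteq> centralizer (centralizer X)"
    by (rule gen_minimal[OF subalgebra_centralizer]) (auto simp: centralizer_def)
  then show "centralizer X \<subseteq> centralizer (subalg_gen scl X)"
    unfolding centralizer_def by (auto simp: subset_iff)
qed

text \<open>Moving \<open>e\<close> past an element of \<open>B\<close> costs only an element of
  \<open>B\<close>, so the only critical term of a product is the one with
  \<open>e * e\<close>.\<close>

lemma subalgebra_adjoin:
  assumes B: "is_subalgebra scl B" and comm: "\<And>b. b \<in> B \<Longrightarrow> e * b + b * e \<in> B"
    and sq: "e * e \<in> adjoin B e"
  shows "is_subalgebra scl (adjoin B e)"
proof -
  note BD = subalgebraD[OF B]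
  note sub = subspace_adjoin[OF subalgebra_subspace[OF B], of e]
  have mem: "p + q * e \<in> adjoin B e" if "p \<in> B" "q \<in> B" for p q
    using that unfolding adjoin_def by blast
  have left: "b * x \<in> adjoin B e" if b: "b \<in> B" and x: "x \<in> adjoin B e" for b x
  proof -
    obtain p q where pq: "p \<in> B" "q \<in> B" "x = p + q * e"
      using x unfolding adjoin_def by blast
    then have "b * x = b * p + b * q * e" by (simp add: algebra_simps)
    moreover have "b * p + b * q * e \<in> adjoin B e"
      by (intro mem BD b pq)
    ultimately show ?thesis by metis
  qed
  have prod: "(p + q * e) * (r + s * e) \<in> adjoin B e"
    if "p \<in> B" "q \<in> B" "r \<in> B" "s \<in> B" for p q r s
  proof -
    let ?r = "e * r + r * e" and ?s = "e * s + s * e"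
    have eq: "(p + q * e) * (r + s * e)
        = (p * r + q * ?r) + (p * s + q * r + q * ?s) * e + q * s * (e * e)"
      by (simp add: algebra_simps)
    have rs: "?r \<in> B" "?s \<in> B" using that comm by blast+
    have "(p * r + q * ?r) + (p * s + q * r + q * ?s) * e \<in> adjoin B e"
      by (rule mem; intro BD(3,4) that rs)
    moreover have "q * s * (e * e) \<in> adjoin B e"
      by (intro left BD(4) that sq)
    ultimately show ?thesis unfolding eq by (rule subspace_add[OF sub])
  qed
  have "1 \<in> adjoin B e" using mem[OF BD(1,2)] by simp
  moreover have "x * y \<in> adjoin B e" if "x \<in> adjoin B e" "y \<in> adjoin B e" for x y
    using that prod by (elim adjoinE) simp
  ultimately show ?thesis
    by (intro subalgebraI subspace_add[OF sub] subspace_scale[OF sub])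
qed

lemma gen_insert_eq_adjoin:
  assumes comm: "\<And>b. b \<in> subalg_gen scl X \<Longrightarrow> e * b + b * e \<in> subalg_gen scl X"
    and sq: "e * e \<in> adjoin (subalg_gen scl X) e"
  shows "subalg_gen scl (insert e X) = adjoin (subalg_gen scl X) e"
proof
  let ?B = "subalg_gen scl X"
  note B = subalgebra_gen[of X]
  note BD = subalgebraD[OF B]
  show "subalg_gen scl (insert e X) \<subseteq> adjoin ?B e"
  proof (rule gen_minimal[OF subalgebra_adjoin[OF B comm sq]])
    have "e \<in> adjoin ?B e" by (rule adjoinI[OF BD(2,1)]) simp
    moreover have "x \<in> adjoin ?B e" if "x \<in> X" for x
      by (rule adjoinI[OF gen_base[OF that] BD(2)]) simp
    ultimately show "insert e X \<subseteq> adjoin ?B e" by blast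
  qed
  note GD = subalgebraD[OF subalgebra_gen[of "insert e X"]]
  have mono: "x \<in> subalg_gen scl (insert e X)" if "x \<in> ?B" for x
    using that gen_mono[of X "insert e X"] by blast
  show "adjoin ?B e \<subseteq> subalg_gen scl (insert e X)"
  proof
    fix x assume "x \<in> adjoin ?B e"
    then obtain p q where pq: "p \<in> ?B" "q \<in> ?B" and x: "x = p + q * e" by (rule adjoinE)
    show "x \<in> subalg_gen scl (insert e X)"
      unfolding x by (intro GD mono pq gen_base insertI1)
  qed
qed

text \<open>By the Leibniz rule, an inner derivation preserves a subalgebra as soon as it maps the
  generators into it.\<close>

lemma commutator_gen:
  assumes "\<And>x. x \<in> X \<Longrightarrow> e * x + x * e \<in> subalg_gen scl X" and "b \<in> subalg_gen scl X"
  shows "e * b + b * e \<in> subalg_gen scl X"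
proof -
  let ?G = "subalg_gen scl X"
  note GD = subalgebraD[OF subalgebra_gen[of X]]
  let ?T = "{b \<in> ?G. e * b + b * e \<in> ?G}"
  have mult: "e * (x * y) + x * y * e = (e * x + x * e) * y + x * (e * y + y * e)" for x y
    by (simp add: algebra_simps)
  have "is_subalgebra scl ?T"
  proof (rule subalgebraI)
    show "1 \<in> ?T" using GD(1,2) by simp
  next
    fix x y assume xy: "x \<in> ?T" "y \<in> ?T"
    have "e * (x + y) + (x + y) * e = (e * x + x * e) + (e * y + y * e)"
      by (simp add: algebra_simps)
    then show "x + y \<in> ?T" using xy GD(3) by simp
    have "e * (x * y) + x * y * e \<in> ?G"
      unfolding mult by (rule GD(3)[OF GD(4) GD(4)]) (use xy in auto)
    then show "x * y \<in> ?T" using xy GD(4)[of x y] by blast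
  next
    fix c x assume x: "x \<in> ?T"
    have "e * scl c x + scl c x * e = scl c (e * x + x * e)"
      by (simp add: scale_right_distrib scl_mult)
    then show "scl c x \<in> ?T" using x GD(5) by simp
  qed
  then have "?G \<subseteq> ?T" by (rule gen_minimal) (use assms(1) gen_base in auto)
  then show ?thesis using assms(2) by blast
qed

end

subsection \<open>Quaternion subalgebras with orthogonal involution\<close>

locale char2_involution = char2_algebra scl Basis
  for scl :: "'f::field \<Rightarrow> 'a::ring_1 \<Rightarrow> 'a" and Basis :: "'a set" +
  fixes \<sigma> :: "'a \<Rightarrow> 'a"
  assumes sigma_add: "\<sigma> (x + y) = \<sigma> x + \<sigma> y"
    and sigma_mult: "\<sigma> (x * y) = \<sigma> y * \<sigma> x"
    and sigma_sigma [simp]: "\<sigma> (\<sigma> x) = x"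
    and sigma_scl: "\<sigma> (scl c x) = scl c (\<sigma> x)"
    and one_notin_Alt: "1 \<notin> Alt \<sigma>"
begin

section \<open>Alternating elements\<close>

lemma sigma_0 [simp]: "\<sigma> 0 = 0"
  using sigma_scl[of 0 0] by simp

lemma sigma_1 [simp]: "\<sigma> 1 = 1"
proof -
  have "\<sigma> (1 * \<sigma> 1) = \<sigma> (\<sigma> 1) * \<sigma> 1" by (rule sigma_mult)
  then show ?thesis by simp
qed

lemma AltI: "x = y + \<sigma> y \<Longrightarrow> x \<in> Alt \<sigma>"
  unfolding Alt_def by auto

lemma AltE:
  assumes "x \<in> Alt \<sigma>"
  obtains y where "x = y + \<sigma> y"
  using assms unfolding Alt_def by auto

lemma Alt_add: "x \<in> Alt \<sigma> \<Longrightarrow> y \<in> Alt \<sigma> \<Longrightarrow> x + y \<in> Alt \<sigma>"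
proof (elim AltE)
  fix a b assume "x = a + \<sigma> a" "y = b + \<sigma> b"
  then show "x + y \<in> Alt \<sigma>"
    by (intro AltI[of _ "a + b"]) (simp add: sigma_add algebra_simps)
qed

lemma Alt_conj: "x \<in> Alt \<sigma> \<Longrightarrow> \<sigma> a * x * a \<in> Alt \<sigma>"
proof (elim AltE)
  fix b assume "x = b + \<sigma> b"
  then show "\<sigma> a * x * a \<in> Alt \<sigma>"
    by (intro AltI[of _ "\<sigma> a * b * a"]) (simp add: sigma_mult algebra_simps)
qed

lemma Alt_scl: "x \<in> Alt \<sigma> \<Longrightarrow> scl c x \<in> Alt \<sigma>"
proof (elim AltE)
  fix a assume "x = a + \<sigma> a"
  then show "scl c x \<in> Alt \<sigma>"
    by (intro AltI[of _ "scl c a"]) (simp add: sigma_scl scale_right_distrib)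
qed

lemma zero_in_Alt: "0 \<in> Alt \<sigma>"
  by (rule AltI[of _ 0]) simp

lemma one_neq_0: "(1::'a) \<noteq> 0"
  using one_notin_Alt zero_in_Alt by metis

text \<open>A nonzero scalar could be rescaled to \<open>1\<close>, which is not alternating.
  Orthogonality of the involution mostly enters in this form.\<close>

lemma scalar_in_Alt: "scl c 1 \<in> Alt \<sigma> \<Longrightarrow> c = 0"
  using Alt_scl[of "scl c 1" "inverse c"] one_notin_Alt by (cases "c = 0") auto

lemma dim_scalars: "dim (scalars scl) = 1"
proof -
  have "scalars scl = span {1}"
    unfolding scalars_def span_singleton by auto
  then show ?thesis using one_neq_0 by simp
qed

lemma dim_le_1_line:
  assumes "subspace V" "dim V \<le> 1" "u \<in> V" "u \<noteq> 0" "x \<in> V"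
  shows "\<exists>c. x = scl c u"
proof -
  have "span {u} = V"
    by (rule subspace_dim_equal) (use assms in \<open>auto intro: span_minimal[THEN subsetD]\<close>)
  then show ?thesis using assms(5) unfolding span_singleton by auto
qed

text \<open>The two-sided ideal generated by the image \<open>F y\<close> of a rank-one inner derivation would be
  \<open>F y + F q y\<close>, a proper one.\<close>

lemma quaternion_inner_derivation_rank:
  assumes Q: "is_quaternion_subalgebra scl Q" and u: "u \<in> Q" and q: "q \<in> Q"
    and y: "y = u * q + q * u" "y \<noteq> 0"
    and line: "\<And>x. x \<in> Q \<Longrightarrow> \<exists>c. u * x + x * u = scl c y"
  shows False
proof -
  have sub: "is_subalgebra scl Q" and simple: "simple_on Q" and dimQ: "dim Q = 4"
    using Q unfolding is_quaternion_subalgebra_def central_simple_on_def fdim_def by auto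
  note QD = subalgebraD[OF sub]
  let ?D = "\<lambda>x. u * x + x * u"
  have D_mult: "?D (x * z) = ?D x * z + x * ?D z" for x z
    by (simp add: algebra_simps)
  let ?I = "span {y, q * y}"
  have yQ: "y \<in> Q" using u q QD y(1) by auto
  have yI: "y \<in> ?I" and qyI: "q * y \<in> ?I" by (auto intro: span_base)
  have I_D: "\<exists>\<alpha> \<beta>. x = scl \<alpha> y + scl \<beta> (q * y)" if "x \<in> ?I" for x
  proof -
    obtain \<alpha> \<beta> where "x - scl \<alpha> y = scl \<beta> (q * y)"
      using \<open>x \<in> ?I\<close> unfolding span_insert[of y] span_singleton by blast
    then have "x = scl \<alpha> y + scl \<beta> (q * y)"
      by (metis add.commute diff_add_cancel)
    then show ?thesis by blast
  qed
  have line_I: "x \<in> ?I" if "\<exists>c. x = scl c y" for x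
    using that yI span_scale by auto
  have both: "r * y \<in> ?I \<and> y * r \<in> ?I" if r: "r \<in> Q" for r
  proof -
    obtain c where c: "?D r = scl c y" using line[OF r] by blast
    \<comment> \<open>Correcting \<open>r\<close> by a multiple of \<open>q\<close> makes it commute
      with \<open>u\<close>. For such a \<open>k\<close> the Leibniz rule exhibits
      \<open>k * y\<close> and \<open>y * k\<close> as values of \<open>?D\<close>, which lie on the
      line \<open>F y\<close>.\<close>
    define k where "k = r + scl c q"
    have kQ: "k \<in> Q" unfolding k_def using r q QD by auto
    have "?D k = ?D r + scl c (?D q)"
      unfolding k_def by (simp add: algebra_simps scl_mult)
    then have Dk: "?D k = 0" using c y(1) by simp
    have r_eq: "r = k + scl c q" unfolding k_def by (simp add: add.assoc)
    have "k * y = ?D (k * q)" unfolding D_mult Dk y(1) by simp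
    then have 1: "k * y \<in> ?I" using line[of "k * q"] kQ q QD line_I by simp
    have "y * k = ?D (q * k)" unfolding D_mult Dk y(1) by simp
    then have 2: "y * k \<in> ?I" using line[of "q * k"] kQ q QD line_I by simp
    \<comment> \<open>This controls the remaining product \<open>y * q\<close>: it differs from
      \<open>q * y\<close> by a multiple of \<open>y\<close>.\<close>
    have "?D (q * q) = y * q + q * y" unfolding D_mult y(1) by simp
    then have "y * q + q * y \<in> ?I" using line[of "q * q"] q QD line_I by simp
    then have "(y * q + q * y) + q * y \<in> ?I" using qyI by (rule span_add)
    then have 3: "y * q \<in> ?I" by (simp add: add.assoc)
    have "r * y = k * y + scl c (q * y)" "y * r = y * k + scl c (y * q)"
      unfolding r_eq by (simp_all add: algebra_simps scl_mult)
    then show ?thesis using 1 2 3 qyI by (auto intro: span_add span_scale)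
  qed
  have "is_ideal_in Q ?I"
    unfolding is_ideal_in_def
  proof (intro conjI ballI)
    show "?I \<subseteq> Q"
      by (rule span_minimal) (use yQ q QD subalgebra_subspace[OF sub] in auto)
    show "0 \<in> ?I" by (rule span_zero)
    show "s + t \<in> ?I" if "s \<in> ?I" "t \<in> ?I" for s t using that by (rule span_add)
    fix r s assume r: "r \<in> Q" and "s \<in> ?I"
    then obtain \<alpha> \<beta> where s: "s = scl \<alpha> y + scl \<beta> (q * y)" using I_D by blast
    have "r * s = scl \<alpha> (r * y) + scl \<beta> (r * q * y)"
      unfolding s by (simp add: algebra_simps scl_mult)
    moreover have "r * q \<in> Q" using r q QD by blast
    ultimately show "r * s \<in> ?I" using both r by (auto intro: span_add span_scale)
    obtain \<gamma> \<delta> where yr: "y * r = scl \<gamma> y + scl \<delta> (q * y)"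
      using both[OF r] I_D by blast
    have "s * r = scl \<alpha> (y * r) + scl \<beta> (q * (y * r))"
      unfolding s by (simp add: algebra_simps scl_mult)
    moreover have "q * (y * r) = scl \<gamma> (q * y) + scl \<delta> (q * q * y)"
      unfolding yr by (simp add: algebra_simps scl_mult)
    moreover have "q * q * y \<in> ?I" using both q QD by blast
    ultimately show "s * r \<in> ?I" using both[OF r] qyI by (auto intro: span_add span_scale)
  qed
  then have "?I = {0} \<or> ?I = Q" using simple unfolding simple_on_def by blast
  then have "Q = ?I" using yI y(2) by auto
  then have "dim Q \<le> card {y, q * y}"
    by (intro dim_le_card) auto
  also have "\<dots> \<le> 2" by (simp add: card_insert_if)
  finally show False using dimQ by simp
qed

text \<open>As \<open>1\<close> is symmetric but not alternating, the alternating elements of \<open>Q\<close> form a line \<open>F u\<close>.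
  It contains \<open>u * x + \<sigma> x * u\<close> for all \<open>x\<close>, so \<open>Q u\<close> is a two-sided ideal and \<open>u\<close> is invertible.\<close>

lemma quaternion_generators:
  assumes Q: "is_quaternion_subalgebra scl Q" and stable: "\<sigma> ` Q \<subseteq> Q"
  obtains u v a c where "u \<in> Q" "v \<in> Q" "a \<noteq> 0" "u * u = scl a 1" "v * v = v + scl c 1"
    "u * v + v * u = u" "\<sigma> u = u" "\<sigma> v = v" "subalg_gen scl {u, v} = Q"
proof -
  have sub: "is_subalgebra scl Q" and simple: "simple_on Q" and dimQ: "dim Q = 4"
    and centre: "centre_on Q = scalars scl"
    using Q unfolding is_quaternion_subalgebra_def central_simple_on_def fdim_def by auto
  note QD = subalgebraD[OF sub]
  note QS = subalgebra_subspace[OF sub]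
  have sQ: "\<sigma> x \<in> Q" if "x \<in> Q" for x using stable that by auto
  let ?tau = "\<lambda>x. x + \<sigma> x"
  have tau_0: "?tau x = 0 \<longleftrightarrow> \<sigma> x = x" for x
    by (simp add: eq_commute[of x "\<sigma> x"])
  let ?S = "{x \<in> Q. \<sigma> x = x}" and ?T = "?tau ` Q"
  have lin: "Vector_Spaces.linear scl scl ?tau"
    by (rule linearI) (simp_all add: algebra_simps sigma_add sigma_scl)
  interpret tau: Vector_Spaces.linear scl scl ?tau by (fact lin)
  have T: "subspace ?T" using QS by (rule tau.subspace_image)
  have S: "subspace ?S" using QS unfolding subspace_def
    by (auto simp: sigma_add sigma_scl)
  have TS: "?T \<subseteq> ?S" using QD sQ by (auto simp: sigma_add add.commute)
  have dims: "dim ?S + dim ?T = 4" using dim_kernel_image[OF lin QS] dimQ unfolding tau_0 by simp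
  have one_S: "1 \<in> ?S" using QD by simp
  have "1 \<notin> ?T" using one_notin_Alt AltI by blast
  then have "\<not> dim ?S \<le> dim ?T" using subspace_dim_equal[OF T S TS] one_S by metis
  then have T1: "dim ?T \<le> 1" and S3: "dim ?S \<ge> 3" using dims by linarith+
  \<comment> \<open>An antiautomorphism that is the identity on \<open>Q\<close> would make
    \<open>Q\<close> commutative, hence equal to its one-dimensional centre.\<close>
  have "\<exists>x\<in>Q. \<sigma> x \<noteq> x"
  proof (rule ccontr)
    assume "\<not> ?thesis"
    then have id: "\<sigma> x = x" if "x \<in> Q" for x using that by blast
    have "x * y = y * x" if "x \<in> Q" "y \<in> Q" for x y
      using sigma_mult[of x y] id that QD by simp
    then have "Q = scalars scl" using centre unfolding centre_on_def by blast
    then show False using dim_scalars dimQ by simp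
  qed
  then obtain x0 where x0: "x0 \<in> Q" "\<sigma> x0 \<noteq> x0" by blast
  define u where "u = ?tau x0"
  have uT: "u \<in> ?T" using x0 u_def by blast
  have u0: "u \<noteq> 0" using x0 u_def by auto
  have uQ: "u \<in> Q" using uT TS by blast
  have su: "\<sigma> u = u" using uT TS by auto
  have lineT: "\<exists>c. x = scl c u" if "x \<in> ?T" for x
    using dim_le_1_line[OF T T1 uT u0 that] .
  have tw: "\<exists>c. u * a + \<sigma> a * u = scl c u" if "a \<in> Q" for a
  proof -
    have "u * a + \<sigma> a * u = ?tau (u * a)" by (simp add: sigma_mult su)
    then show ?thesis using lineT that uQ QD by blast
  qed
  let ?I = "(\<lambda>q. q * u) ` Q"
  have "is_ideal_in Q ?I"
    unfolding is_ideal_in_def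
  proof (intro conjI ballI)
    show "?I \<subseteq> Q" using QD uQ by blast
    have "0 * u \<in> ?I" using QD(2) by blast
    then show "0 \<in> ?I" by simp
    fix s t assume "s \<in> ?I" "t \<in> ?I"
    then obtain p q where "p \<in> Q" "q \<in> Q" "s = p * u" "t = q * u" by blast
    then show "s + t \<in> ?I"
      by (intro image_eqI[of _ _ "p + q"]) (simp_all add: distrib_right QD(3))
  next
    fix r s assume r: "r \<in> Q" "s \<in> ?I"
    then obtain q where q: "q \<in> Q" "s = q * u" by blast
    have "r * s = (r * q) * u" using q by (simp add: mult.assoc)
    then show "r * s \<in> ?I" using r q QD(4) by blast
    obtain c where c: "u * r + \<sigma> r * u = scl c u" using tw r by blast
    then have "u * r = scl c u + \<sigma> r * u" by (rule move_summand)
    then have eq: "s * r = (scl c q + q * \<sigma> r) * u"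
      using q by (simp add: algebra_simps scl_mult)
    show "s * r \<in> ?I"
    proof (rule image_eqI)
      show "s * r = (scl c q + q * \<sigma> r) * u" by (fact eq)
      show "scl c q + q * \<sigma> r \<in> Q" by (intro QD(3,4,5) q(1) sQ r(1))
    qed
  qed
  then have "?I = {0} \<or> ?I = Q" using simple unfolding simple_on_def by blast
  moreover have "u \<in> ?I" by (rule image_eqI[of _ _ 1]) (simp_all add: QD(1))
  ultimately have I_Q: "?I = Q" using u0 by (metis singletonD)
  have "1 \<in> ?I" unfolding I_Q by (rule QD(1))
  then obtain q1 where q1: "q1 * u = 1" by (metis imageE)
  have q1': "u * \<sigma> q1 = 1" using arg_cong[OF q1, of \<sigma>] by (simp add: sigma_mult su)
  \<comment> \<open>The cube of \<open>u\<close> is alternating, so it is a multiple of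
    \<open>u\<close>; cancelling with the right inverse \<open>\<sigma> q1\<close> makes
    \<open>u * u\<close> a scalar.\<close>
  have "\<exists>a. u * u * u = scl a u"
  proof (rule lineT)
    have "u * u * u = u * (x0 + \<sigma> x0) * u" by (simp only: u_def)
    also have "\<dots> = ?tau (u * x0 * u)" by (simp add: sigma_mult su algebra_simps)
    finally show "u * u * u \<in> ?T" by (rule image_eqI) (intro QD(4) uQ x0(1))
  qed
  then obtain a where uuu: "u * u * u = scl a u" by blast
  have "u * u = u * u * u * \<sigma> q1" by (simp add: mult.assoc q1')
  also have "\<dots> = scl a (u * \<sigma> q1)" unfolding uuu by (simp add: scl_mult)
  finally have uu: "u * u = scl a 1" using q1' by simp
  have a0: "a \<noteq> 0"
  proof
    assume "a = 0"
    then have "q1 * (u * u) = 0" using uu by simp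
    then show False using q1 u0 by (simp flip: mult.assoc)
  qed
  have cancel: "x = 0" if "x * u = 0" for x
  proof -
    have "x * (u * \<sigma> q1) = 0" using that by (simp flip: mult.assoc)
    then show ?thesis using q1' by simp
  qed
  have u_notin: "u \<notin> scalars scl"
  proof
    assume "u \<in> scalars scl"
    then obtain c where "u = scl c 1" unfolding scalars_def by auto
    moreover have "u \<in> Alt \<sigma>" using u_def AltI by blast
    ultimately show False using scalar_in_Alt u0 by fastforce
  qed
  \<comment> \<open>If \<open>u\<close> commuted with the symmetric elements, which have dimension
    at least 3, its inner derivation would have rank at most 1. The rank is not 0 because
    \<open>u\<close> is not central, so \<open>quaternion_inner_derivation_rank\<close>
    applies.\<close>
  have "\<exists>s\<in>?S. u * s + s * u \<noteq> 0"
  proof (rule ccontr)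
    assume "\<not> ?thesis"
    then have comm: "u * s + s * u = 0" if "s \<in> ?S" for s using that by blast
    let ?D = "\<lambda>x. u * x + x * u"
    have linD: "Vector_Spaces.linear scl scl ?D"
      by (rule linearI) (simp_all add: algebra_simps scl_mult)
    interpret D: Vector_Spaces.linear scl scl ?D by (fact linD)
    have DQ: "subspace (?D ` Q)" using QS by (rule D.subspace_image)
    have "dim ?S \<le> dim {x \<in> Q. ?D x = 0}" by (rule dim_subset) (use comm in auto)
    then have D1: "dim (?D ` Q) \<le> 1" using dim_kernel_image[OF linD QS] dimQ S3 by simp
    have "\<exists>q\<in>Q. u * q \<noteq> q * u"
      using u_notin uQ unfolding centre[symmetric] centre_on_def by blast
    then obtain q where q: "q \<in> Q" "?D q \<noteq> 0" by auto
    show False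
    proof (rule quaternion_inner_derivation_rank[OF Q uQ q(1) refl q(2)])
      fix x assume "x \<in> Q"
      then show "\<exists>c. ?D x = scl c (?D q)"
        by (intro dim_le_1_line[OF DQ D1 _ q(2)]) (use q in auto)
    qed
  qed
  then obtain s where s: "s \<in> Q" "\<sigma> s = s" "u * s + s * u \<noteq> 0" by auto
  obtain c where c: "u * s + s * u = scl c u" using tw[OF s(1)] s(2) by auto
  then have c0: "c \<noteq> 0" using s(3) by auto
  \<comment> \<open>The scaling normalizes the commutator of \<open>u\<close> and \<open>v\<close>
    to \<open>u\<close>.\<close>
  define v where "v = scl (inverse c) s"
  have vQ: "v \<in> Q" unfolding v_def using s QD by blast
  have sv: "\<sigma> v = v" unfolding v_def by (simp add: sigma_scl s)
  have "u * v + v * u = scl (inverse c) (u * s + s * u)"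
    unfolding v_def by (simp add: algebra_simps scl_mult)
  then have uv: "u * v + v * u = u" using c c0 by simp
  have uv': "u * v = v * u + u" using move_summand[OF uv] by (simp add: add.commute)
  \<comment> \<open>Adjoining \<open>u\<close> to the scalars and then \<open>v\<close> doubles the
    dimension twice: \<open>v\<close> detects \<open>u\<close> by its commutator, and conversely. So
    \<open>u\<close> and \<open>v\<close> generate all of \<open>Q\<close>.\<close>
  let ?B = "adjoin (scalars scl) u"
  have F: "subspace (scalars scl)" using subalgebra_subspace[OF subalgebra_scalars] .
  have dimB: "dim ?B = 2 * dim (scalars scl)"
  proof (rule dim_adjoin(1)[where f = v and h = u, OF F])
    show "b * v = v * b" if "b \<in> scalars scl" for b using that unfolding scalars_def by auto
    show "v * u + u * v = u" using uv by (simp add: add.commute)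
  qed (rule cancel)
  have "dim (adjoin ?B v) = 2 * dim ?B"
  proof (rule dim_adjoin(1)[where f = u and h = u, OF subspace_adjoin[OF F]])
    fix b assume "b \<in> ?B"
    then obtain p q where "b = scl p 1 + scl q 1 * u"
      unfolding scalars_def by (auto elim!: adjoinE)
    then show "b * u = u * b" by (simp add: distrib_left distrib_right scl_mult)
  qed (rule uv, rule cancel)
  then have dim4: "dim (adjoin ?B v) = 4" using dimB dim_scalars by simp
  have adj_gen: "adjoin ?B v \<subseteq> subalg_gen scl {u, v}"
  proof
    note G = subalgebra_gen[of "{u, v}"]
    have F_G: "x \<in> subalg_gen scl {u, v}" if "x \<in> scalars scl" for x
      using that scalars_subset[OF G] by blast
    have uv_G: "u \<in> subalg_gen scl {u, v}" "v \<in> subalg_gen scl {u, v}"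
      by (rule gen_base; simp)+
    fix x assume "x \<in> adjoin ?B v"
    then obtain b b' where b: "b \<in> ?B" "b' \<in> ?B" and x: "x = b + b' * v" by (rule adjoinE)
    from b(1) obtain p q where p: "p \<in> scalars scl" "q \<in> scalars scl" "b = p + q * u"
      by (rule adjoinE)
    from b(2) obtain p' q' where p': "p' \<in> scalars scl" "q' \<in> scalars scl" "b' = p' + q' * u"
      by (rule adjoinE)
    show "x \<in> subalg_gen scl {u, v}"
      unfolding x p(3) p'(3) by (intro subalgebraD(3,4)[OF G] F_G p p' uv_G)
  qed
  have gen_Q: "subalg_gen scl {u, v} \<subseteq> Q"
    by (rule gen_minimal[OF sub]) (use uQ vQ in auto)
  have "adjoin ?B v = Q"
    by (rule subspace_dim_equal[OF subspace_adjoin[OF subspace_adjoin[OF F]] QS])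
      (use adj_gen gen_Q dim4 dimQ in simp_all)
  then have gen: "subalg_gen scl {u, v} = Q" using adj_gen gen_Q by blast
  \<comment> \<open>Conjugation by \<open>u\<close> sends \<open>v\<close> to \<open>v + 1\<close>,
    which has the same Artin-Schreier value \<open>v * v + v\<close>.\<close>
  have "v * v + v \<in> centralizer {u, v}"
  proof -
    have 1: "(u * v) * v = v * (u * v) + u * v" by (subst uv') (simp add: algebra_simps)
    have 2: "v * (u * v) = (v * v + v) * u" by (subst uv') (simp add: algebra_simps)
    have "u * (v * v + v) = (u * v) * v + u * v" by (simp add: algebra_simps)
    then have "u * (v * v + v) = (v * v + v) * u" unfolding 1 by (simp add: 2 add.assoc)
    then show ?thesis unfolding centralizer_def by (auto simp: algebra_simps)
  qed
  then have "v * v + v \<in> centralizer Q" using gen centralizer_gen by metis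
  then have "v * v + v \<in> centre_on Q"
    unfolding centre_on_def centralizer_def using vQ QD by auto
  then obtain e where "v * v + v = scl e 1" unfolding centre scalars_def by auto
  then have "v * v = scl e 1 + v" by (rule move_summand)
  then have "v * v = v + scl e 1" by (simp only: add.commute)
  then show ?thesis using that uQ vQ a0 uu uv su sv gen by blast
qed

end

subsection \<open>The standard inseparable subalgebra\<close>

text \<open>Each factor is presented in Artin-Schreier form: \<open>v i\<close> generates a
  quadratic etale algebra, and conjugation by the invertible \<open>u i\<close> sends
  \<open>v i\<close> to \<open>v i + 1\<close>. Generators of different factors commute.\<close>

locale quaternion_decomposition = char2_involution scl Basis \<sigma>
  for scl :: "'f::field \<Rightarrow> 'a::ring_1 \<Rightarrow> 'a" and Basis :: "'a set" and \<sigma> :: "'a \<Rightarrow> 'a" +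
  fixes n :: nat and u v :: "nat \<Rightarrow> 'a" and a c :: "nat \<Rightarrow> 'f"
  assumes central: "centralizer UNIV \<subseteq> scalars scl"
    and a_nz: "i < n \<Longrightarrow> a i \<noteq> 0"
    and u_sq: "i < n \<Longrightarrow> u i * u i = scl (a i) 1"
    and v_sq: "i < n \<Longrightarrow> v i * v i = v i + scl (c i) 1"
    and u_v: "i < n \<Longrightarrow> u i * v i + v i * u i = u i"
    and sigma_u: "i < n \<Longrightarrow> \<sigma> (u i) = u i"
    and sigma_v: "i < n \<Longrightarrow> \<sigma> (v i) = v i"
    and u_u: "i < n \<Longrightarrow> j < n \<Longrightarrow> u i * u j = u j * u i"
    and v_v: "i < n \<Longrightarrow> j < n \<Longrightarrow> v i * v j = v j * v i"
    and u_v_comm: "i < n \<Longrightarrow> j < n \<Longrightarrow> i \<noteq> j \<Longrightarrow> u i * v j = v j * u i"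
    and generate: "subalg_gen scl (u ` {..<n} \<union> v ` {..<n}) = UNIV"
begin

definition S :: "'a set" where "S = subalg_gen scl (u ` {..<n})"

lemma u_cancel: "i < n \<Longrightarrow> x * u i = 0 \<Longrightarrow> x = 0"
proof -
  assume i: "i < n" and "x * u i = 0"
  then have "x * (u i * u i) = 0" by (simp flip: mult.assoc)
  then show "x = 0" using u_sq[OF i] a_nz[OF i] by simp
qed

lemma subalgebra_S: "is_subalgebra scl S"
  unfolding S_def by (rule subalgebra_gen)

lemmas S_closed = subalgebraD[OF subalgebra_S]

lemma u_in_S: "i < n \<Longrightarrow> u i \<in> S"
  unfolding S_def by (rule gen_base) auto

lemma commute_gen_iff:
  "(\<forall>b\<in>subalg_gen scl X. b * f = f * b) \<longleftrightarrow> (\<forall>b\<in>X. b * f = f * b)"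
proof -
  have "f \<in> centralizer (subalg_gen scl X) \<longleftrightarrow> f \<in> centralizer X" by (simp only: centralizer_gen)
  then show ?thesis unfolding centralizer_def by (simp add: eq_commute[of "f * _"])
qed

text \<open>Each \<open>u k\<close> doubles the dimension: \<open>v k\<close> commutes with the
  earlier generators, while its commutator with \<open>u k\<close> is \<open>u k\<close> itself,
  which is invertible.\<close>

lemma dim_u_gen: "k \<le> n \<Longrightarrow> dim (subalg_gen scl (u ` {..<k})) = 2 ^ k"
proof (induction k)
  case 0
  have "subalg_gen scl {} = scalars scl"
    using gen_minimal[OF subalgebra_scalars, of "{}"] scalars_subset[OF subalgebra_gen, of "{}"]
    by auto
  then show ?case using dim_scalars by simp
next
  case (Suc k)
  let ?G = "subalg_gen scl (u ` {..<k})"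
  have k: "k < n" using Suc.prems by simp
  have comm: "b * u k = u k * b" if "b \<in> ?G" for b
    using that commute_gen_iff[of "u ` {..<k}" "u k"] u_u k by auto
  have comm': "b * v k = v k * b" if "b \<in> ?G" for b
    using that commute_gen_iff[of "u ` {..<k}" "v k"] u_v_comm k by auto
  have "subalg_gen scl (u ` {..<Suc k}) = subalg_gen scl (insert (u k) (u ` {..<k}))"
    by (simp add: lessThan_Suc)
  also have "\<dots> = adjoin ?G (u k)"
  proof (rule gen_insert_eq_adjoin)
    show "u k * b + b * u k \<in> ?G" if "b \<in> ?G" for b
      using comm[OF that] subalgebraD[OF subalgebra_gen] by simp
    show "u k * u k \<in> adjoin ?G (u k)"
      by (rule adjoinI[where q = 0 and p = "scl (a k) 1"])
        (auto simp: u_sq[OF k] subalgebraD[OF subalgebra_gen])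
  qed
  also have "dim \<dots> = 2 * dim ?G"
  proof (rule dim_adjoin(1)[where f = "v k" and h = "u k"])
    show "v k * u k + u k * v k = u k" using u_v[OF k] by (simp add: add.commute)
  qed (use subalgebra_subspace[OF subalgebra_gen] comm' u_cancel[OF k] in auto)
  finally show ?case using Suc by simp
qed

text \<open>A chain of subalgebras that climbs from \<open>S\<close> at \<open>k = 0\<close> to the
  whole algebra at \<open>k = n\<close>.\<close>

definition gen_upto :: "nat \<Rightarrow> 'a set" where
  "gen_upto k = subalg_gen scl (v ` {..<k} \<union> u ` {..<n})"

text \<open>Here \<open>u\<close> and \<open>v\<close> exchange roles: \<open>u k\<close> commutes
  with \<open>gen_upto k\<close> and has commutator \<open>u k\<close> with \<open>v k\<close>. The
  last claim allows descending the chain by commuting with \<open>u k\<close>.\<close>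

lemma gen_upto_Suc:
  assumes k: "k < n"
  shows "gen_upto (Suc k) = adjoin (gen_upto k) (v k)"
    and "dim (gen_upto (Suc k)) = 2 * dim (gen_upto k)"
    and "{x \<in> gen_upto (Suc k). x * u k = u k * x} = gen_upto k"
proof -
  let ?X = "v ` {..<k} \<union> u ` {..<n}"
  note GD = subalgebraD[OF subalgebra_gen[of ?X]]
  have u_G: "u i \<in> subalg_gen scl ?X" if "i < n" for i
    using that by (intro gen_base) auto
  have "v k * x + x * v k \<in> subalg_gen scl ?X" if "x \<in> ?X" for x
    using that
  proof (elim UnE imageE)
    fix i assume "x = v i" "i \<in> {..<k}"
    then show ?thesis using v_v[of i k] k GD(2) by simp
  next
    fix i assume x: "x = u i" and i: "i \<in> {..<n}"
    show ?thesis
    proof (cases "i = k")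
      case True
      then show ?thesis using x u_v[OF k] u_G[OF k] by (simp add: add.commute)
    next
      case False
      then show ?thesis using x i u_v_comm[of i k] k GD(2) by simp
    qed
  qed
  note comm = commutator_gen[OF this]
  have "v k * v k \<in> adjoin (subalg_gen scl ?X) (v k)"
    by (rule adjoinI[where p = "scl (c k) 1" and q = 1])
      (auto simp: v_sq[OF k] add.commute intro: GD)
  then have *: "subalg_gen scl (insert (v k) ?X) = adjoin (subalg_gen scl ?X) (v k)"
    by (intro gen_insert_eq_adjoin comm)
  have "v ` {..<Suc k} \<union> u ` {..<n} = insert (v k) ?X" by (auto simp: lessThan_Suc)
  then show 1: "gen_upto (Suc k) = adjoin (gen_upto k) (v k)"
    unfolding gen_upto_def using * by simp
  have "\<forall>b\<in>?X. b * u k = u k * b" using k by (auto intro: u_u u_v_comm[symmetric])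
  then have comm_u: "b * u k = u k * b" if "b \<in> gen_upto k" for b
    using that commute_gen_iff[of ?X "u k"] unfolding gen_upto_def by blast
  have sub: "subspace (gen_upto k)"
    unfolding gen_upto_def by (rule subalgebra_subspace[OF subalgebra_gen])
  show "dim (gen_upto (Suc k)) = 2 * dim (gen_upto k)"
    unfolding 1 by (rule dim_adjoin(1)[OF sub comm_u u_v[OF k] u_cancel[OF k]])
  show "{x \<in> gen_upto (Suc k). x * u k = u k * x} = gen_upto k"
    unfolding 1 by (rule dim_adjoin(2)[OF sub comm_u u_v[OF k] u_cancel[OF k]])
qed

lemma gen_upto_0: "gen_upto 0 = S"
  unfolding gen_upto_def S_def by simp

lemma gen_upto_n: "gen_upto n = UNIV"
  unfolding gen_upto_def using generate by (simp add: Un_commute)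

lemma dim_S: "dim S = 2 ^ n"
  unfolding S_def by (rule dim_u_gen) simp

lemma dim_UNIV_eq: "dim UNIV = 4 ^ n"
proof -
  have "dim (gen_upto k) = 2 ^ k * 2 ^ n" if "k \<le> n" for k
    using that by (induction k) (simp_all add: gen_upto_0 dim_S gen_upto_Suc(2))
  from this[of n] show ?thesis by (simp add: gen_upto_n flip: power_mult_distrib)
qed

lemma alg_degree_eq: "alg_degree scl = 2 ^ n"
  unfolding alg_degree_def fdim_def
proof (rule the_equality)
  show "2 ^ n * 2 ^ n = dim (UNIV :: 'a set)"
    unfolding dim_UNIV_eq by (simp flip: power_mult_distrib)
  fix d assume "d * d = dim (UNIV :: 'a set)"
  then have "d ^ 2 = (2 ^ n) ^ 2"
    unfolding dim_UNIV_eq by (simp add: power2_eq_square flip: power_mult_distrib)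
  then show "d = 2 ^ n" by (simp add: power2_eq_iff_nonneg)
qed

text \<open>Commuting with the \<open>u i\<close>, from the last to the first, pushes
  \<open>x\<close> down the chain \<open>gen_upto\<close> until it reaches \<open>S\<close>.\<close>

lemma centralizer_u: "centralizer (u ` {..<n}) \<subseteq> S"
proof
  fix x assume x: "x \<in> centralizer (u ` {..<n})"
  have "x \<in> gen_upto (n - k)" for k
  proof (induction k)
    case 0
    then show ?case by (simp add: gen_upto_n)
  next
    case (Suc k)
    show ?case
    proof (cases "k < n")
      case True
      then have "n - Suc k < n" "Suc (n - Suc k) = n - k" by auto
      with gen_upto_Suc(3)[of "n - Suc k"] Suc x show ?thesis
        unfolding centralizer_def by auto
    next
      case False
      then show ?thesis using Suc by simp
    qed
  qed
  from this[of n] show "x \<in> S" by (simp add: gen_upto_0)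
qed

lemma S_commute: "x \<in> S \<Longrightarrow> y \<in> S \<Longrightarrow> x * y = y * x"
proof -
  have "S \<subseteq> centralizer (u ` {..<n})"
    unfolding S_def by (rule gen_minimal[OF subalgebra_centralizer]) (auto simp: centralizer_def u_u)
  then have "S \<subseteq> centralizer S"
    using centralizer_gen unfolding S_def by metis
  then show "x \<in> S \<Longrightarrow> y \<in> S \<Longrightarrow> x * y = y * x" unfolding centralizer_def by blast
qed

lemma centralizer_S: "centralizer S = S"
proof
  show "centralizer S \<subseteq> S"
    using centralizer_u centralizer_gen unfolding S_def by metis
  show "S \<subseteq> centralizer S"
    using S_commute unfolding centralizer_def by blast
qed

text \<open>On the commutative algebra \<open>S\<close> squaring is additive and multiplicative, so
  the symmetric elements of \<open>S\<close> with scalar square form a subalgebra; it contains the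
  generators.\<close>

lemma S_subset_Sym_plus: "S \<subseteq> Sym_plus scl \<sigma>"
proof -
  let ?T = "{x \<in> S. \<sigma> x = x \<and> x * x \<in> scalars scl}"
  note FD = subalgebraD[OF subalgebra_scalars]
  have "is_subalgebra scl ?T"
  proof (rule subalgebraI)
    show "1 \<in> ?T" using S_closed(1) FD(1) by simp
  next
    fix x y assume xy: "x \<in> ?T" "y \<in> ?T"
    then have comm: "x * y = y * x" using S_commute by blast
    have "(x + y) * (x + y) = x * x + y * y + (x * y + y * x)" by (simp add: algebra_simps)
    then have "(x + y) * (x + y) = x * x + y * y" by (simp add: comm)
    then show "x + y \<in> ?T" using xy S_closed(3) FD(3) by (simp add: sigma_add)
    have "x * y * (x * y) = (x * x) * (y * y)"
      by (metis comm mult.assoc)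
    then show "x * y \<in> ?T" using xy S_closed(4) FD(4) comm by (simp add: sigma_mult)
  next
    fix k x assume "x \<in> ?T"
    then show "scl k x \<in> ?T" using S_closed(5) FD(5) by (simp add: sigma_scl scl_mult)
  qed
  then have "S \<subseteq> ?T"
    by (subst S_def, rule gen_minimal)
      (auto simp: u_in_S sigma_u u_sq scalars_def)
  then show ?thesis unfolding Sym_plus_def Sym_def by blast
qed

lemma inseparable_S: "is_inseparable_subalgebra scl \<sigma> S"
  unfolding is_inseparable_subalgebra_def
  using alg_degree_eq subalgebra_S dim_S S_subset_Sym_plus centralizer_S S_def fdim_def by metis

lemma inseparable_subset_S:
  assumes "is_inseparable_subalgebra scl \<sigma> S'" "S' \<subseteq> S"
  shows "S' = S"
proof -
  have "centralizer S' = S'" using assms(1) unfolding is_inseparable_subalgebra_def by blast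
  moreover have "centralizer S \<subseteq> centralizer S'" using assms(2) unfolding centralizer_def by blast
  ultimately show ?thesis using centralizer_S assms(2) by blast
qed

end

subsection \<open>Anisotropic involutions\<close>

text \<open>Treat the operators one after another: if \<open>D k y\<close> is not zero, replace
  \<open>y\<close> by it. This vector is killed by \<open>D k\<close>, and by commutation still by
  the earlier operators. \<open>P\<close> need only be stable under the operators.\<close>

lemma common_kernel:
  fixes D :: "nat \<Rightarrow> 'b \<Rightarrow> 'b::zero"
  assumes "P x" "x \<noteq> 0"
    and closed: "\<And>i y. i < n \<Longrightarrow> P y \<Longrightarrow> P (D i y)"
    and square: "\<And>i y. i < n \<Longrightarrow> P y \<Longrightarrow> D i (D i y) = 0"
    and commute: "\<And>i j y. i < n \<Longrightarrow> j < n \<Longrightarrow> P y \<Longrightarrow> D i (D j y) = D j (D i y)"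
    and zero: "\<And>i. D i 0 = 0"
  obtains y where "P y" "y \<noteq> 0" "\<And>i. i < n \<Longrightarrow> D i y = 0"
proof -
  have "\<exists>y. P y \<and> y \<noteq> 0 \<and> (\<forall>i<k. D i y = 0)" if "k \<le> n" for k
    using that
  proof (induction k)
    case 0
    then show ?case using assms(1,2) by blast
  next
    case (Suc k)
    then obtain y where y: "P y" "y \<noteq> 0" "\<forall>i<k. D i y = 0" by auto
    show ?case
    proof (cases "D k y = 0")
      case True
      then show ?thesis using y by (auto simp: less_Suc_eq intro!: exI[of _ y])
    next
      case False
      have "D i (D k y) = 0" if "i < Suc k" for i
      proof (cases "i = k")
        case True
        then show ?thesis using square[of k y] Suc.prems y by simp
      next
        case False
        then have "D i (D k y) = D k (D i y)" using commute[of i k y] Suc.prems that y by simp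
        then show ?thesis using False that y zero by simp
      qed
      then show ?thesis using False closed[of k y] Suc.prems y by auto
    qed
  qed
  then show ?thesis using that by blast
qed

section \<open>The commuting derivations of \<open>S\<close> and the criterion for
  anisotropy\<close>

context quaternion_decomposition
begin

text \<open>These commuting idempotent derivations act on \<open>S\<close> as degree operators: a
  product of distinct \<open>u i\<close> is an eigenvector, with eigenvalue 1 exactly at the indices
  that occur in it.\<close>

definition der :: "nat \<Rightarrow> 'a \<Rightarrow> 'a" where "der i x = v i * x + x * v i"

lemma der_0 [simp]: "der i 0 = 0"
  by (simp add: der_def)

lemma der_scalar [simp]: "der i (scl k 1) = 0"
  by (simp add: der_def)

lemma der_add: "der i (x + y) = der i x + der i y"
  by (simp add: der_def algebra_simps)

lemma der_mult: "der i (x * y) = der i x * y + x * der i y"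
  by (simp add: der_def algebra_simps)

lemma v_mult: "v i * x = x * v i + der i x"
  by (simp add: der_def algebra_simps)

lemma der_der: "i < n \<Longrightarrow> der i (der i x) = der i x"
proof -
  assume i: "i < n"
  have "der i (der i x) = (v i * v i) * x + x * (v i * v i)"
    by (simp add: der_def algebra_simps)
  then show ?thesis unfolding v_sq[OF i] by (simp add: der_def algebra_simps)
qed

lemma der_commute: "i < n \<Longrightarrow> j < n \<Longrightarrow> der i (der j x) = der j (der i x)"
proof -
  assume ij: "i < n" "j < n"
  have "der i (der j x) = (v i * v j) * x + v i * x * v j + v j * x * v i + x * (v j * v i)"
    by (simp add: der_def algebra_simps)
  also have "\<dots> = (v j * v i) * x + v i * x * v j + v j * x * v i + x * (v i * v j)"
    by (simp only: v_v[OF ij])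
  also have "\<dots> = der j (der i x)"
    by (simp add: der_def algebra_simps)
  finally show ?thesis .
qed

lemma der_u: "i < n \<Longrightarrow> j < n \<Longrightarrow> der i (u j) = (if i = j then u j else 0)"
  using u_v[of i] u_v_comm[of j i] by (auto simp: der_def add.commute)

lemma der_S: "i < n \<Longrightarrow> x \<in> S \<Longrightarrow> der i x \<in> S"
  unfolding der_def S_def
  by (rule commutator_gen)
    (use der_u in \<open>auto simp: der_def u_in_S S_closed simp flip: S_def\<close>)

text \<open>Such an \<open>x\<close> commutes with all generators \<open>u i\<close> and
  \<open>v i\<close>, so it is central.\<close>

lemma S_scalar:
  assumes "x \<in> S" "\<And>i. i < n \<Longrightarrow> der i x = 0"
  obtains k where "x = scl k 1"
proof -
  have "x * y = y * x" if "y \<in> u ` {..<n} \<union> v ` {..<n}" for y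
    using that
  proof (elim UnE imageE)
    fix i assume "y = u i" "i \<in> {..<n}"
    then show ?thesis using S_commute[OF assms(1) u_in_S] by simp
  next
    fix i assume "y = v i" "i \<in> {..<n}"
    then show ?thesis using v_mult[of i x] assms(2) by simp
  qed
  then have "x \<in> centralizer (u ` {..<n} \<union> v ` {..<n})" unfolding centralizer_def by blast
  then have "x \<in> centralizer UNIV" unfolding generate[symmetric] centralizer_gen .
  then show ?thesis using central that unfolding scalars_def by blast
qed

lemma S_sq:
  assumes "x \<in> S"
  obtains k where "x * x = scl k 1"
  using S_subset_Sym_plus assms unfolding Sym_plus_def scalars_def by blast

lemma sigma_S: "x \<in> S \<Longrightarrow> \<sigma> x = x"
  using S_subset_Sym_plus unfolding Sym_plus_def Sym_def by blast

text \<open>The operators \<open>y \<mapsto> u i * der i y\<close> commute and square to zero. A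
  common kernel vector is killed by all \<open>der i\<close>, so it is a scalar, and a nonzero
  scalar does not square to zero.\<close>

lemma square_zero_stable:
  assumes "P x" and sq: "\<And>y. P y \<Longrightarrow> y \<in> S \<and> y * y = 0"
    and closed: "\<And>i y. i < n \<Longrightarrow> P y \<Longrightarrow> P (u i * der i y)"
  shows "x = 0"
proof (rule ccontr)
  assume "x \<noteq> 0"
  have u_der: "der i (u i * der i y) = 0" if "i < n" for i y
    using that by (simp add: der_mult der_u der_der)
  obtain y where y: "P y" "y \<noteq> 0" "\<And>i. i < n \<Longrightarrow> u i * der i y = 0"
  proof (rule common_kernel[of P x n "\<lambda>i y. u i * der i y", OF \<open>P x\<close> \<open>x \<noteq> 0\<close>])
    fix i j y assume ij: "i < n" "j < n"
    show "u i * der i (u j * der j y) = u j * der j (u i * der i y)"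
    proof (cases "i = j")
      case False
      then have "u i * der i (u j * der j y) = u i * u j * der i (der j y)"
        "u j * der j (u i * der i y) = u j * u i * der j (der i y)"
        using ij by (simp_all add: der_mult der_u mult.assoc)
      then show ?thesis using u_u[OF ij] der_commute[OF ij] by simp
    qed simp
  qed (use closed u_der in auto)
  have yS: "y \<in> S" and yy: "y * y = 0" using sq y(1) by auto
  have "der i y = 0" if "i < n" for i
  proof (rule u_cancel[OF that])
    show "der i y * u i = 0"
      using y(3)[OF that] S_commute[OF der_S[OF that yS] u_in_S[OF that]] by simp
  qed
  then obtain k where "y = scl k 1" using S_scalar yS by blast
  then show False using yy y(2) one_neq_0 by auto
qed

text \<open>For a simultaneous eigenvector, multiplication by \<open>u i\<close> lowers the
  \<open>i\<close>-th degree from 1 to 0 and keeps the other degrees and the square zero, so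
  \<open>square_zero_stable\<close> applies to the homogeneous elements.\<close>

lemma square_zero_homogeneous:
  assumes "x \<in> S" "x * x = 0" "\<And>i. i < n \<Longrightarrow> der i x = 0 \<or> der i x = x"
  shows "x = 0"
proof (rule square_zero_stable[where P =
      "\<lambda>y. y \<in> S \<and> y * y = 0 \<and> (\<forall>i<n. der i y = 0 \<or> der i y = y)"])
  fix i y assume i: "i < n" and y: "y \<in> S \<and> y * y = 0 \<and> (\<forall>i<n. der i y = 0 \<or> der i y = y)"
  show "u i * der i y \<in> S \<and> u i * der i y * (u i * der i y) = 0 \<and>
      (\<forall>j<n. der j (u i * der i y) = 0 \<or> der j (u i * der i y) = u i * der i y)"
  proof (cases "der i y = 0")
    case True
    then show ?thesis using S_closed(2) by simp
  next
    case False
    then have eq: "der i y = y" using y i by blast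
    have comm: "u i * y = y * u i" using S_commute u_in_S i y by blast
    have "u i * y * (u i * y) = u i * (y * y) * u i" by (simp add: comm commute_left[OF comm[symmetric]] mult.assoc)
    then have 1: "u i * y * (u i * y) = 0" using y by simp
    have 2: "der j (u i * y) = 0 \<or> der j (u i * y) = u i * y" if "j < n" for j
      using y that i eq by (auto simp: der_mult der_u)
    show ?thesis unfolding eq using 1 2 S_closed(4) u_in_S[OF i] y by blast
  qed
qed (use assms in auto)

text \<open>The involution interchanges the two mixed terms of the product, so their sum is
  alternating.\<close>

lemma Alt_norm_add:
  assumes "\<sigma> x * x \<in> Alt \<sigma>" "\<sigma> y * y \<in> Alt \<sigma>"
  shows "\<sigma> (x + y) * (x + y) \<in> Alt \<sigma>"
proof -
  have "\<sigma> x * y + \<sigma> y * x \<in> Alt \<sigma>"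
    by (rule AltI[of _ "\<sigma> x * y"]) (simp add: sigma_mult)
  then have "(\<sigma> x * x + \<sigma> y * y) + (\<sigma> x * y + \<sigma> y * x) \<in> Alt \<sigma>"
    by (intro Alt_add[OF Alt_add[OF assms]])
  also have "(\<sigma> x * x + \<sigma> y * y) + (\<sigma> x * y + \<sigma> y * x) = \<sigma> (x + y) * (x + y)"
    by (simp add: sigma_add algebra_simps)
  finally show ?thesis .
qed

text \<open>The elements \<open>x\<close> with \<open>\<sigma> x * x\<close> alternating form a right ideal that is stable under left
  multiplication by \<open>S\<close>; the commuting nilpotent operators \<open>y \<mapsto> u i * y + y * u i\<close> on it
  have a common kernel vector, which lies in \<open>S\<close>.\<close>

lemma Alt_norm_imp_zero:
  assumes reduced: "\<And>s. s \<in> S \<Longrightarrow> s * s = 0 \<Longrightarrow> s = 0" and x: "\<sigma> x * x \<in> Alt \<sigma>"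
  shows "x = 0"
proof (rule ccontr)
  assume "x \<noteq> 0"
  let ?P = "\<lambda>y. \<sigma> y * y \<in> Alt \<sigma>" and ?D = "\<lambda>i y. u i * y + y * u i"
  obtain y where y: "?P y" "y \<noteq> 0" "\<And>i. i < n \<Longrightarrow> ?D i y = 0"
  proof (rule common_kernel[of ?P x n ?D, OF x \<open>x \<noteq> 0\<close>])
    fix i y assume i: "i < n" and y: "\<sigma> y * y \<in> Alt \<sigma>"
    have "\<sigma> (u i * y) * (u i * y) = \<sigma> y * (u i * u i) * y"
      by (simp add: sigma_mult sigma_u[OF i] mult.assoc)
    also have "\<dots> = scl (a i) (\<sigma> y * y)" by (simp add: u_sq[OF i] scl_mult)
    finally have "\<sigma> (u i * y) * (u i * y) \<in> Alt \<sigma>" using Alt_scl[OF y] by simp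
    moreover have "\<sigma> (y * u i) * (y * u i) \<in> Alt \<sigma>"
      using Alt_conj[OF y, of "u i"] by (simp add: sigma_mult mult.assoc)
    ultimately show "\<sigma> (?D i y) * ?D i y \<in> Alt \<sigma>" by (rule Alt_norm_add)
    have "?D i (?D i y) = u i * u i * y + y * (u i * u i)" by (simp add: algebra_simps)
    then show "?D i (?D i y) = 0" by (simp add: u_sq[OF i])
  next
    fix i j y assume ij: "i < n" "j < n"
    have "?D i (?D j y) = (u i * u j) * y + u i * y * u j + u j * y * u i + y * (u j * u i)"
      by (simp add: algebra_simps)
    also have "\<dots> = (u j * u i) * y + u i * y * u j + u j * y * u i + y * (u i * u j)"
      by (simp only: u_u[OF ij])
    also have "\<dots> = ?D j (?D i y)"
      by (simp add: algebra_simps)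
    finally show "?D i (?D j y) = ?D j (?D i y)" .
  qed auto
  have "y \<in> centralizer (u ` {..<n})" unfolding centralizer_def using y(3) by auto
  then have yS: "y \<in> S" using centralizer_u by blast
  obtain k where k: "y * y = scl k 1" using S_sq[OF yS] .
  have "k = 0" using y(1) k sigma_S[OF yS] scalar_in_Alt by simp
  then show False using reduced[OF yS] k y(2) by simp
qed

text \<open>Isotropy can be tested on \<open>S\<close>: there \<open>\<sigma> s * s\<close> is
  \<open>s * s\<close>, and conversely \<open>0\<close> is alternating, so
  \<open>Alt_norm_imp_zero\<close> covers all isotropic vectors.\<close>

lemma anisotropic_iff_reduced:
  "anisotropic \<sigma> \<longleftrightarrow> (\<forall>s\<in>S. s * s = 0 \<longrightarrow> s = 0)"
proof
  assume "anisotropic \<sigma>"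
  then show "\<forall>s\<in>S. s * s = 0 \<longrightarrow> s = 0"
    unfolding anisotropic_def using sigma_S by metis
next
  assume "\<forall>s\<in>S. s * s = 0 \<longrightarrow> s = 0"
  then show "anisotropic \<sigma>"
    unfolding anisotropic_def using Alt_norm_imp_zero zero_in_Alt by metis
qed

lemma anisotropic_Sym_plus_subset:
  assumes "anisotropic \<sigma>"
  shows "Sym_plus scl \<sigma> \<subseteq> S"
proof
  fix x assume "x \<in> Sym_plus scl \<sigma>"
  then obtain k where sx: "\<sigma> x = x" and xx: "x * x = scl k 1"
    unfolding Sym_plus_def Sym_def scalars_def by blast
  have "x * s = s * x" if s: "s \<in> S" for s
  proof -
    obtain l where ss: "s * s = scl l 1" using S_sq[OF s] .
    let ?z = "x * s + s * x"
    \<comment> \<open>The two terms in parentheses are both the product of the scalars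
      \<open>x * x\<close> and \<open>s * s\<close> and cancel; the other two are interchanged by
      \<open>\<sigma>\<close>.\<close>
    have "?z * ?z = x * s * x * s + s * x * s * x + (x * (s * s) * x + s * (x * x) * s)"
      by (simp add: algebra_simps)
    also have "x * (s * s) * x + s * (x * x) * s = 0"
      by (simp add: ss xx scl_mult mult.commute)
    finally have "?z * ?z = x * s * x * s + s * x * s * x" by simp
    moreover have "\<sigma> ?z = ?z" by (simp add: sigma_add sigma_mult sx sigma_S[OF s] add.commute)
    ultimately have "\<sigma> ?z * ?z \<in> Alt \<sigma>"
      by (intro AltI[of _ "x * s * x * s"]) (simp add: sigma_mult sx sigma_S[OF s] mult.assoc)
    then have "?z = 0"
      using Alt_norm_imp_zero assms anisotropic_iff_reduced by blast
    then show ?thesis by simp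
  qed
  then have "x \<in> centralizer S" unfolding centralizer_def by blast
  then show "x \<in> S" by (simp add: centralizer_S)
qed

end

subsection \<open>Degrees two and four\<close>

context quaternion_decomposition
begin

lemma UNIV_eq_adjoin: "n = Suc m \<Longrightarrow> UNIV = adjoin (gen_upto m) (v m)"
  using gen_upto_n gen_upto_Suc(1)[of m] by simp

text \<open>Write \<open>x = p + q * v 0\<close> with \<open>p\<close>, \<open>q\<close> in
  \<open>S\<close>. Symmetry makes \<open>q\<close> a scalar \<open>l\<close>, and the commutator of
  \<open>u 0\<close> with the central \<open>x * x\<close> is \<open>l * l\<close> times
  \<open>u 0\<close>, so \<open>l = 0\<close>.\<close>

lemma Sym_plus_subset_degree_2:
  assumes n: "n = 1"
  shows "Sym_plus scl \<sigma> \<subseteq> S"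
proof
  fix x assume "x \<in> Sym_plus scl \<sigma>"
  then obtain k where sx: "\<sigma> x = x" and xx: "x * x = scl k 1"
    unfolding Sym_plus_def Sym_def scalars_def by blast
  have "x \<in> adjoin S (v 0)" using UNIV_eq_adjoin[of 0] n gen_upto_0 by auto
  then obtain p q where p: "p \<in> S" and q: "q \<in> S" and x: "x = p + q * v 0" by (rule adjoinE)
  have 0: "0 < n" using n by simp
  have "v 0 * q = q * v 0"
    using sx unfolding x by (simp add: sigma_add sigma_mult sigma_S p q sigma_v[OF 0])
  then have dq: "der 0 q = 0" by (simp add: der_def)
  then obtain l where l: "q = scl l 1" using S_scalar[OF q] n by auto
  have up: "u 0 * p = p * u 0" using S_commute u_in_S[OF 0] p by blast
  have uv: "u 0 * v 0 = v 0 * u 0 + u 0" using move_summand[OF u_v[OF 0]] by (simp add: add.commute)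
  have ux: "u 0 * x = x * u 0 + scl l (u 0)"
    unfolding x l by (simp add: algebra_simps up uv scl_mult scale_right_distrib)
  have "u 0 * (x * x) = (u 0 * x) * x" by (simp add: mult.assoc)
  also have "\<dots> = x * (u 0 * x) + scl l (u 0 * x)" by (subst ux) (simp add: algebra_simps scl_mult)
  also have "\<dots> = x * x * u 0 + scl l (scl l (u 0))"
    unfolding ux by (simp add: algebra_simps scl_mult scale_right_distrib)
  finally have "scl (l * l) (u 0) = 0" by (simp add: xx)
  moreover have "u 0 \<noteq> 0" using u_cancel[OF 0, of 1] one_neq_0 by auto
  ultimately have "l = 0" by simp
  then show "x \<in> S" using x l p by simp
qed

text \<open>An alternating \<open>z\<close> has the form \<open>s + t1 * v 0 + t2 * v 1\<close> with
  coefficients in \<open>S\<close>. Centrality of \<open>z * z\<close> gives quadratic relations for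
  \<open>t1\<close> and \<open>t2\<close>, whose homogeneous components turn out to square to zero
  and hence vanish.\<close>

lemma Alt_Sym_plus_subset_degree_4:
  assumes n: "n = 2" and z: "z \<in> Alt \<sigma>" and zz: "z * z \<in> scalars scl"
  shows "z \<in> S"
proof -
  have 0: "0 < n" and 1: "1 < n" using n by simp_all
  note [simp del] = One_nat_def
  obtain y where y: "z = y + \<sigma> y" using z by (rule AltE)
  have "y \<in> adjoin (gen_upto 1) (v 1)" using UNIV_eq_adjoin[of 1] n by auto
  then obtain y0 y1 where y01: "y0 \<in> gen_upto 1" "y1 \<in> gen_upto 1" "y = y0 + y1 * v 1"
    by (rule adjoinE)
  have gen_1: "gen_upto 1 = adjoin S (v 0)" using gen_upto_Suc(1)[OF 0] gen_upto_0 by (simp add: One_nat_def)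
  obtain p0 p1 where p0: "p0 \<in> S" "p1 \<in> S" "y0 = p0 + p1 * v 0"
    using y01(1) unfolding gen_1 by (rule adjoinE)
  obtain p2 p where p2: "p2 \<in> S" "p \<in> S" "y1 = p2 + p * v 0"
    using y01(2) unfolding gen_1 by (rule adjoinE)
  \<comment> \<open>In \<open>y + \<sigma> y\<close> the monomial \<open>v 0 * v 1\<close> with its
    coefficient \<open>p\<close> cancels, and reordering \<open>\<sigma> y\<close> leaves
    derivatives of \<open>p\<close> as coefficients of \<open>v 0\<close> and
    \<open>v 1\<close>.\<close>
  define t1 t2 where "t1 = der 1 p" and "t2 = der 0 p"
  define e where "e = der 0 t1"
  define s where "s = der 0 p1 + der 1 p2 + e"
  have S: "t1 \<in> S" "t2 \<in> S" "e \<in> S" "s \<in> S"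
    unfolding t1_def t2_def e_def s_def by (intro der_S S_closed(3) 0 1 p0 p2)+
  have e': "der 1 t2 = e" unfolding e_def t1_def t2_def by (rule der_commute[OF 1 0])
  have d11: "der 1 t1 = t1" unfolding t1_def by (rule der_der[OF 1])
  have d02: "der 0 t2 = t2" unfolding t2_def by (rule der_der[OF 0])
  have d0e: "der 0 e = e" unfolding e_def by (rule der_der[OF 0])
  have d1e: "der 1 e = e" unfolding e'[symmetric] by (rule der_der[OF 1])
  have z_eq: "z = s + t1 * v 0 + t2 * v 1"
  proof -
    have y_eq: "y = p0 + p1 * v 0 + p2 * v 1 + p * v 0 * v 1"
      unfolding y01(3) p0(3) p2(3) by (simp add: algebra_simps)
    have "\<sigma> y = p0 + v 0 * p1 + v 1 * p2 + v 1 * (v 0 * p)"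
      unfolding y_eq
      by (simp add: sigma_add sigma_mult sigma_S p0(1,2) p2(1,2) sigma_v[OF 0] sigma_v[OF 1])
    also have "v 1 * (v 0 * p) = (v 1 * p) * v 0 + v 1 * t2"
      unfolding t2_def by (simp add: v_mult[of 0 p] algebra_simps)
    also have "v 1 * t2 = t2 * v 1 + e" using v_mult[of 1 t2] e' by simp
    also have "v 1 * p = p * v 1 + t1" unfolding t1_def by (rule v_mult)
    also have "v 0 * p1 = p1 * v 0 + der 0 p1" by (rule v_mult)
    also have "v 1 * p2 = p2 * v 1 + der 1 p2" by (rule v_mult)
    finally have "\<sigma> y = p0 + (p1 * v 0 + der 0 p1) + (p2 * v 1 + der 1 p2) +
        ((p * v 1 + t1) * v 0 + (t2 * v 1 + e))" .
    then show ?thesis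
      unfolding y y_eq s_def by (simp add: algebra_simps v_v[OF 1 0])
  qed
  obtain k where k: "z * z = scl k 1" using zz unfolding scalars_def by blast
  text \<open>This is the vanishing of the commutator of \<open>z * z\<close> with \<open>u i\<close>.\<close>
  have comm_z: "t * (e + t1 + t2) = 0"
    if i: "i < n" and t: "t \<in> S" and uz: "u i * z + z * u i = t * u i"
      and dt: "der 0 (t * u i) = (if i = 0 then e + t else t) * u i"
        "der 1 (t * u i) = (if i = 1 then e + t else t) * u i"
      and ti: "t = (if i = 0 then t1 else t2)"
    for i t
  proof (rule u_cancel[OF i])
    let ?w = "t * u i"
    have w: "?w \<in> S" using S_closed(4) t u_in_S[OF i] by blast
    have "z * ?w + ?w * z = z * (u i * z + z * u i) + (u i * z + z * u i) * z"
      unfolding uz by simp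
    also have "\<dots> = (z * z) * u i + u i * (z * z)" by (simp add: algebra_simps)
    finally have "z * ?w + ?w * z = 0" by (simp add: k)
    moreover have "z * ?w + ?w * z = t1 * der 0 ?w + t2 * der 1 ?w"
    proof -
      have "z * ?w = ?w * s + t1 * (v 0 * ?w) + t2 * (v 1 * ?w)"
        unfolding z_eq using S_commute[OF S(4) w] by (simp add: distrib_right mult.assoc)
      also have "v 0 * ?w = ?w * v 0 + der 0 ?w" by (rule v_mult)
      also have "v 1 * ?w = ?w * v 1 + der 1 ?w" by (rule v_mult)
      also have "?w * s + t1 * (?w * v 0 + der 0 ?w) + t2 * (?w * v 1 + der 1 ?w) =
          (?w * s + (t1 * ?w) * v 0 + (t2 * ?w) * v 1) + (t1 * der 0 ?w + t2 * der 1 ?w)"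
        by (simp add: algebra_simps)
      also have "?w * s + (t1 * ?w) * v 0 + (t2 * ?w) * v 1 = ?w * z"
        unfolding z_eq S_commute[OF S(1) w] S_commute[OF S(2) w] by (simp add: algebra_simps)
      finally show ?thesis by (simp add: add.commute)
    qed
    moreover have "t1 * der 0 ?w + t2 * der 1 ?w = t * (e + t1 + t2) * u i"
    proof (cases "i = 0")
      case True
      then have "t1 * der 0 ?w + t2 * der 1 ?w = (t1 * (e + t1) + t2 * t1) * u i"
        unfolding dt using ti by (simp add: distrib_right mult.assoc)
      also have "t2 * t1 = t1 * t2" by (rule S_commute[OF S(2,1)])
      finally show ?thesis using True ti by (simp add: distrib_left add.assoc)
    next
      case False
      then have i1: "i = 1" using i n by simp
      then have "t1 * der 0 ?w + t2 * der 1 ?w = (t1 * t2 + t2 * (e + t2)) * u i"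
        unfolding dt using ti by (simp add: distrib_right mult.assoc)
      also have "t1 * t2 = t2 * t1" by (rule S_commute[OF S(1,2)])
      finally show ?thesis using i1 ti by (simp add: distrib_left add_ac)
    qed
    ultimately show "t * (e + t1 + t2) * u i = 0" by simp
  qed
  have u_S: "u i * x = x * u i" if "i < n" "x \<in> S" for i x
    using S_commute u_in_S that by blast
  have uz: "u i * z = z * u i + (if i = 0 then t1 else t2) * u i" if i: "i < n" for i
  proof -
    have uv: "u i * v j = v j * u i + (if i = j then u i else 0)" if "j < n" for j
      using u_v_comm[of i j] move_summand[OF u_v[OF i]] i that by (auto simp: add.commute)
    have "u i * z = s * u i + t1 * (u i * v 0) + t2 * (u i * v 1)"
      unfolding z_eq using u_S[OF i] S by (simp add: distrib_left flip: mult.assoc)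
    also have "\<dots> = z * u i + t1 * (if i = 0 then u i else 0) + t2 * (if i = 1 then u i else 0)"
      unfolding z_eq uv[OF 0] uv[OF 1] by (simp add: algebra_simps)
    finally show ?thesis using i n by (cases "i = 0") auto
  qed
  have uz': "u i * z + z * u i = (if i = 0 then t1 else t2) * u i" if i: "i < n" for i
    using uz[OF i] by (simp add: add_ac)
  have eq1: "t1 * (e + t1 + t2) = 0"
    by (rule comm_z[OF 0 S(1)])
      (use uz'[OF 0] e_def d11 in \<open>simp_all add: der_mult der_u[OF 0 0] der_u[OF 1 0] distrib_right\<close>)
  have eq2: "t2 * (e + t1 + t2) = 0"
    by (rule comm_z[OF 1 S(2)])
      (use uz'[OF 1] e' d02 in \<open>simp_all add: der_mult der_u[OF 0 1] der_u[OF 1 1] distrib_right\<close>)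
  \<comment> \<open>With respect to \<open>der 0\<close> and \<open>der 1\<close>, the elements
    \<open>\<alpha>\<close>, \<open>\<beta>\<close>, \<open>e\<close> have degrees (0,1), (1,0),
    (1,1).\<close>
  define \<alpha> \<beta> where "\<alpha> = t1 + e" and "\<beta> = t2 + e"
  have t_eq: "t1 = \<alpha> + e" "t2 = \<beta> + e" unfolding \<alpha>_def \<beta>_def by (simp_all add: add.assoc)
  have AB: "\<alpha> \<in> S" "\<beta> \<in> S" unfolding \<alpha>_def \<beta>_def using S S_closed(3) by blast+
  have d: "der 0 \<alpha> = 0" "der 1 \<alpha> = \<alpha>" "der 0 \<beta> = \<beta>" "der 1 \<beta> = 0"
    unfolding \<alpha>_def \<beta>_def using e_def e' d11 d02 d0e d1e by (simp_all add: der_add)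
  have c: "\<beta> * \<alpha> = \<alpha> * \<beta>" "e * \<alpha> = \<alpha> * e" "e * \<beta> = \<beta> * e"
    using S_commute AB S(3) by blast+
  have E1: "\<alpha> * \<alpha> + e * e = \<alpha> * \<beta> + \<beta> * e"
  proof -
    have "(\<alpha> + e) * (\<alpha> + \<beta> + e) = 0"
      using eq1 unfolding t_eq by (simp add: add_ac)
    then have "(\<alpha> * \<alpha> + e * e) + (\<alpha> * \<beta> + \<beta> * e) = 0"
      by (simp add: algebra_simps c)
    then show ?thesis by (simp only: add_eq_0_iff_eq)
  qed
  have E2: "\<beta> * \<beta> + e * e = \<alpha> * \<beta> + \<alpha> * e"
  proof -
    have "(\<beta> + e) * (\<alpha> + \<beta> + e) = 0"
      using eq2 unfolding t_eq by (simp add: add_ac)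
    then have "(\<beta> * \<beta> + e * e) + (\<alpha> * \<beta> + \<alpha> * e) = 0"
      by (simp add: algebra_simps c)
    then show ?thesis by (simp only: add_eq_0_iff_eq)
  qed
  \<comment> \<open>Squares in \<open>S\<close> are scalars, so derivations kill the left sides of
    \<open>E1\<close> and \<open>E2\<close>; on the right sides they separate the products by
    degree.\<close>
  have der_sq: "der i (x * x) = 0" if "x \<in> S" for i x
    by (rule S_sq[OF that]) simp
  have "der 0 (\<alpha> * \<beta> + \<beta> * e) = 0" unfolding E1[symmetric] by (simp add: der_add der_sq AB S)
  then have ab: "\<alpha> * \<beta> = 0" by (simp add: der_add der_mult d d0e)
  have "der 1 (\<alpha> * \<beta> + \<beta> * e) = 0" unfolding E1[symmetric] by (simp add: der_add der_sq AB S)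
  then have be: "\<beta> * e = 0" by (simp add: ab der_mult d d1e)
  have "der 0 (\<alpha> * \<beta> + \<alpha> * e) = 0" unfolding E2[symmetric] by (simp add: der_add der_sq AB S)
  then have ae: "\<alpha> * e = 0" by (simp add: ab der_mult d d0e)
  have aa: "\<alpha> * \<alpha> = e * e" and bb: "\<beta> * \<beta> = e * e"
    using E1 E2 ab ae be by simp_all
  obtain l where l: "e * e = scl l 1" using S_sq[OF S(3)] .
  have "scl l e = \<alpha> * (\<alpha> * e)" using aa l by (simp flip: mult.assoc)
  then have "l = 0 \<or> e = 0" using ae by simp
  then have ee: "e * e = 0" using l by auto
  have lt2: "i = 0 \<or> i = 1" if "i < n" for i using that n by auto
  have "e = 0" by (rule square_zero_homogeneous[OF S(3) ee]) (use lt2 d0e d1e in auto)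
  moreover have "\<alpha> = 0" by (rule square_zero_homogeneous[OF AB(1)]) (use aa ee lt2 d in auto)
  moreover have "\<beta> = 0" by (rule square_zero_homogeneous[OF AB(2)]) (use bb ee lt2 d in auto)
  ultimately show "z \<in> S" using z_eq t_eq S(4) by simp
qed

text \<open>The centralizer of \<open>x\<close> has dimension at least 8. On it the commutator with
  \<open>y\<close> squares to zero and has the 4-dimensional kernel \<open>S'\<close>, so its image
  is all of \<open>S'\<close> and contains \<open>1\<close>. A preimage \<open>w\<close> of
  \<open>1\<close> yields the required alternating elements of \<open>S'\<close>.\<close>

lemma inseparable_degree_4_subset:
  assumes n: "n = 2" and x: "x \<in> Sym_plus scl \<sigma>" and y: "y \<in> Sym_plus scl \<sigma>"
    and xy: "x * y = y * x"
    and S': "S' = centralizer {x, y}" "dim S' = 4" "S' \<subseteq> Sym_plus scl \<sigma>"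
  shows "x \<in> S"
proof -
  obtain k where sx: "\<sigma> x = x" and xx: "x * x = scl k 1"
    using x unfolding Sym_plus_def Sym_def scalars_def by blast
  obtain l where sy: "\<sigma> y = y" and yy: "y * y = scl l 1"
    using y unfolding Sym_plus_def Sym_def scalars_def by blast
  have sub: "is_subalgebra scl S'" unfolding S' by (rule subalgebra_centralizer)
  note SD = subalgebraD[OF sub]
  have xS: "x \<in> S'" "y \<in> S'" unfolding S' centralizer_def using xy by auto
  let ?X = "\<lambda>z. x * z + z * x" and ?Y = "\<lambda>z. y * z + z * y"
  have linX: "Vector_Spaces.linear scl scl ?X" and linY: "Vector_Spaces.linear scl scl ?Y"
    by (rule linearI; simp add: algebra_simps scl_mult)+
  interpret Y: Vector_Spaces.linear scl scl ?Y by (fact linY)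
  have XX: "?X (?X z) = 0" for z
  proof -
    have "?X (?X z) = x * x * z + z * (x * x)" by (simp add: algebra_simps)
    then show ?thesis by (simp add: xx)
  qed
  have YY: "?Y (?Y z) = 0" for z
  proof -
    have "?Y (?Y z) = y * y * z + z * (y * y)" by (simp add: algebra_simps)
    then show ?thesis by (simp add: yy)
  qed
  have XY: "?X (?Y z) = ?Y (?X z)" for z
  proof -
    have "?X (?Y z) = (x * y) * z + x * z * y + y * z * x + z * (y * x)" by (simp add: algebra_simps)
    also have "\<dots> = (y * x) * z + x * z * y + y * z * x + z * (x * y)" by (simp only: xy)
    also have "\<dots> = ?Y (?X z)" by (simp add: algebra_simps)
    finally show ?thesis .
  qed
  let ?K = "{z \<in> UNIV. ?X z = 0}"
  have K: "subspace ?K"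
    unfolding subspace_def by (auto simp: algebra_simps scl_mult)
  have K8: "dim ?K \<ge> 8"
    using dim_le_twice_dim_kernel[OF linX subspace_UNIV] XX dim_UNIV_eq n by simp
  have YK: "?Y z \<in> ?K" if "z \<in> ?K" for z
    using that XY[of z] by auto
  have ker: "{z \<in> ?K. ?Y z = 0} = S'"
    unfolding S' centralizer_def by (auto simp: eq_commute[of "_ * x"] eq_commute[of "_ * y"])
  have "dim ?K = 4 + dim (?Y ` ?K)"
    using dim_kernel_image[OF linY K] unfolding ker S'(2) .
  then have "dim (?Y ` ?K) \<ge> 4" using K8 by simp
  moreover have "?Y ` ?K \<subseteq> S'" using YK YY unfolding ker[symmetric] by blast
  ultimately have "?Y ` ?K = S'"
    by (intro subspace_dim_equal Y.subspace_image K subalgebra_subspace sub) (use S'(2) in simp_all)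
  then have "1 \<in> ?Y ` ?K" using SD(1) by simp
  then obtain w where w: "?X w = 0" "?Y w = 1" by auto
  have xw: "x * w = w * x" using w(1) by simp
  have xsw: "x * \<sigma> w = \<sigma> w * x" using arg_cong[OF xw, of \<sigma>] by (simp add: sigma_mult sx)
  text \<open>Both \<open>m\<close> and \<open>1 + m * y\<close> are alternating, and at least one of them is invertible.\<close>
  define m where "m = w + \<sigma> w"
  have "?Y (\<sigma> w) = 1" using arg_cong[OF w(2), of \<sigma>] by (simp add: sigma_add sigma_mult sy add.commute)
  then have "?Y m = 0" using w(2) unfolding m_def by (simp add: algebra_simps)
  then have mS: "m \<in> S'"
    unfolding S' centralizer_def m_def using xw xsw by (auto simp: algebra_simps)
  have in_S: "z \<in> S" if "z \<in> S'" "z \<in> Alt \<sigma>" for z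
    using Alt_Sym_plus_subset_degree_4[OF n that(2)] that(1) S'(3) unfolding Sym_plus_def by blast
  \<comment> \<open>A nonzero scalar square makes \<open>r\<close> invertible, so \<open>x\<close>
    is recovered from \<open>r\<close> and \<open>x * r\<close>, both of which lie in
    \<open>S\<close>.\<close>
  have unit: "x \<in> S" if r: "r \<in> S'" "r \<in> Alt \<sigma>" "x * r \<in> Alt \<sigma>" "r * r \<noteq> 0" for r
  proof -
    have "r \<in> S" "x * r \<in> S" using in_S r SD(4) xS by blast+
    then have "x * r * r \<in> S" by (rule S_closed(4)[rotated])
    obtain j where j: "r * r = scl j 1" using S_sq[OF \<open>r \<in> S\<close>] .
    then have "j \<noteq> 0" using r(4) by auto
    have "scl (inverse j) (x * r * r) = x" using j \<open>j \<noteq> 0\<close> by (simp add: mult.assoc)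
    then show "x \<in> S" using S_closed(5)[OF \<open>x * r * r \<in> S\<close>] by metis
  qed
  have "m \<in> Alt \<sigma>" unfolding m_def by (rule AltI) simp
  moreover have "x * m \<in> Alt \<sigma>"
    unfolding m_def by (rule AltI[of _ "x * w"]) (simp add: sigma_mult sx xsw distrib_left)
  ultimately have m_case: "m * m \<noteq> 0 \<Longrightarrow> x \<in> S" using unit mS by blast
  define r where "r = 1 + m * y"
  have ym: "m * y = y * m" using \<open>?Y m = 0\<close> by simp
  have r_eq: "r = y * w + \<sigma> w * y"
  proof -
    have "r = (y * w + w * y) + (w + \<sigma> w) * y" unfolding r_def m_def using w(2) by simp
    then show ?thesis by (simp add: algebra_simps)
  qed
  have "r \<in> S'" unfolding r_def by (intro SD mS xS)
  moreover have "r \<in> Alt \<sigma>" unfolding r_eq by (rule AltI[of _ "y * w"]) (simp add: sigma_mult sy)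
  moreover have "x * r \<in> Alt \<sigma>"
  proof (rule AltI[of _ "x * y * w"])
    have "x * (\<sigma> w * y) = \<sigma> w * (y * x)" by (simp add: xy[symmetric] flip: mult.assoc xsw)
    then show "x * r = x * y * w + \<sigma> (x * y * w)"
      unfolding r_eq by (simp add: sigma_mult sx sy algebra_simps)
  qed
  \<comment> \<open>If \<open>m\<close> is not invertible then \<open>m * y\<close> squares to zero,
    so \<open>1 + m * y\<close> squares to \<open>1\<close>.\<close>
  moreover have "r * r \<noteq> 0" if "m * m = 0"
  proof -
    have "m * y * (m * y) = m * m * (y * y)" by (metis ym mult.assoc)
    then have "r * r = 1" unfolding r_def using that by (simp add: algebra_simps)
    then show ?thesis using one_neq_0 by simp
  qed
  ultimately show "x \<in> S" using unit m_case by blast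
qed

end

subsection \<open>Isotropic involutions of degree at least eight\<close>

context quaternion_decomposition
begin

text \<open>Otherwise the square-zero elements of \<open>S\<close> would be stable under all
  \<open>u i * der i\<close>, and \<open>square_zero_stable\<close> would make them vanish.\<close>

lemma ex_square_zero_moved:
  assumes "s \<in> S" "s * s = 0" "s \<noteq> 0"
  obtains m t where "m < n" "t \<in> S" "t * t = 0" "t * v m * t \<noteq> 0"
proof -
  have "\<exists>m<n. \<exists>t\<in>S. t * t = 0 \<and> t * v m * t \<noteq> 0"
  proof (rule ccontr)
    assume "\<not> ?thesis"
    then have "\<forall>m<n. \<forall>t\<in>S. t * t = 0 \<longrightarrow> t * v m * t = 0" by simp
    then have vanish: "m < n \<Longrightarrow> t \<in> S \<Longrightarrow> t * t = 0 \<Longrightarrow> t * v m * t = 0" for m t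
      by simp
    have "s = 0"
    proof (rule square_zero_stable[where P = "\<lambda>y. y \<in> S \<and> y * y = 0"])
      fix i y assume i: "i < n" and y: "y \<in> S \<and> y * y = 0"
      let ?w = "u i * der i y"
      have dy: "der i y \<in> S" using der_S[OF i] y by blast
      have "y * der i y = y * v i * y + y * y * v i" by (simp add: der_def algebra_simps)
      then have "y * der i y = 0" using vanish[OF i] y by simp
      then have "der i (y * der i y) = 0" by simp
      then have dd: "der i y * der i y = 0"
        unfolding der_mult der_der[OF i] using \<open>y * der i y = 0\<close> by simp
      have "?w * ?w = u i * (der i y * u i) * der i y" by (simp add: mult.assoc)
      also have "der i y * u i = u i * der i y" by (rule S_commute[OF dy u_in_S[OF i]])
      also have "u i * (u i * der i y) * der i y = u i * u i * (der i y * der i y)"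
        by (simp add: mult.assoc)
      finally have "?w * ?w = 0" using dd by simp
      then show "?w \<in> S \<and> ?w * ?w = 0" using S_closed(4)[OF u_in_S[OF i] dy] by blast
    qed (use assms in auto)
    then show False using assms(3) by simp
  qed
  then show ?thesis using that by blast
qed

text \<open>As \<open>g\<close> is symmetric and its own inverse, conjugation by \<open>g\<close> is
  an algebra automorphism of order at most two that commutes with \<open>\<sigma>\<close>.\<close>

lemma inseparable_conj:
  assumes g: "g * g = 1" "\<sigma> g = g" and S': "is_inseparable_subalgebra scl \<sigma> S'"
  shows "is_inseparable_subalgebra scl \<sigma> ((\<lambda>x. g * x * g) ` S')"
proof -
  let ?f = "\<lambda>x. g * x * g"
  obtain m h where m: "alg_degree scl = 2 ^ m" and sub: "is_subalgebra scl S'"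
    and dim: "fdim scl S' = 2 ^ m" and Sp: "S' \<subseteq> Sym_plus scl \<sigma>" and C: "centralizer S' = S'"
    and h: "S' = subalg_gen scl (h ` {..<m})"
    using S' unfolding is_inseparable_subalgebra_def by blast
  have gg: "g * (g * x) = x" for x using g(1) by (simp flip: mult.assoc)
  have ff: "?f (?f x) = x" for x by (simp add: mult.assoc gg g(1))
  have f_add: "?f (x + y) = ?f x + ?f y" for x y by (simp add: algebra_simps)
  have f_mult: "?f (x * y) = ?f x * ?f y" for x y by (simp add: mult.assoc gg)
  have f_scl: "?f (scl k x) = scl k (?f x)" for k x by (simp add: scl_mult)
  have f_1: "?f 1 = 1" using g(1) by simp
  have lin: "Vector_Spaces.linear scl scl ?f"
    by (rule linearI; fact f_add f_scl)
  have mem: "x \<in> ?f ` T \<longleftrightarrow> ?f x \<in> T" for x T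
    using ff by (metis (no_types, lifting) image_iff)
  have f_sub: "is_subalgebra scl (?f ` T)" if T: "is_subalgebra scl T" for T
  proof (rule subalgebraI)
    show "1 \<in> ?f ` T" unfolding mem f_1 by (rule subalgebraD(1)[OF T])
    show "x + y \<in> ?f ` T" if "x \<in> ?f ` T" "y \<in> ?f ` T" for x y
      using that unfolding mem f_add by (rule subalgebraD(3)[OF T])
    show "x * y \<in> ?f ` T" if "x \<in> ?f ` T" "y \<in> ?f ` T" for x y
      using that unfolding mem f_mult by (rule subalgebraD(4)[OF T])
    show "scl k x \<in> ?f ` T" if "x \<in> ?f ` T" for k x
      using that unfolding mem f_scl by (rule subalgebraD(5)[OF T])
  qed
  have f_gen: "?f ` subalg_gen scl X \<subseteq> subalg_gen scl (?f ` X)" for X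
  proof -
    have "subalg_gen scl X \<subseteq> ?f ` subalg_gen scl (?f ` X)"
    proof (rule gen_minimal[OF f_sub[OF subalgebra_gen]], rule subsetI)
      fix x assume "x \<in> X"
      then have "?f x \<in> subalg_gen scl (?f ` X)" by (intro gen_base imageI)
      then show "x \<in> ?f ` subalg_gen scl (?f ` X)" unfolding mem .
    qed
    then show ?thesis using mem by blast
  qed
  have gen: "?f ` S' = subalg_gen scl ((\<lambda>i. ?f (h i)) ` {..<m})"
  proof
    show "?f ` S' \<subseteq> subalg_gen scl ((\<lambda>i. ?f (h i)) ` {..<m})"
      using f_gen[of "h ` {..<m}"] unfolding h[symmetric] image_image .
    show "subalg_gen scl ((\<lambda>i. ?f (h i)) ` {..<m}) \<subseteq> ?f ` S'"
    proof (rule gen_minimal[OF f_sub[OF sub]])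
      have "h ` {..<m} \<subseteq> S'" unfolding h by (rule gen_superset)
      then show "(\<lambda>i. ?f (h i)) ` {..<m} \<subseteq> ?f ` S'" by blast
    qed
  qed
  have "dim (?f ` S') = dim S'"
  proof -
    interpret fp: finite_dimensional_vector_space_pair_1 scl Basis scl by unfold_locales
    have "inj_on ?f (span S')" by (rule inj_on_inverseI[where g = ?f]) (rule ff)
    then show ?thesis by (rule fp.dim_image_eq[OF lin])
  qed
  moreover have "?f ` S' \<subseteq> Sym_plus scl \<sigma>"
  proof
    fix y assume "y \<in> ?f ` S'"
    then obtain x where x: "x \<in> S'" "y = ?f x" by blast
    then obtain k where "\<sigma> x = x" "x * x = scl k 1"
      using Sp unfolding Sym_plus_def Sym_def scalars_def by blast
    then have "\<sigma> y = y" "y * y = scl k 1"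
      using x(2) f_mult[of x x] f_scl[of k 1] f_1 by (simp_all add: sigma_mult g(2) mult.assoc)
    then show "y \<in> Sym_plus scl \<sigma>" unfolding Sym_plus_def Sym_def scalars_def by blast
  qed
  moreover have "centralizer (?f ` S') = ?f ` S'"
  proof -
    have "x \<in> centralizer (?f ` S') \<longleftrightarrow> ?f x \<in> centralizer S'" for x
    proof -
      have "x * ?f y = ?f y * x \<longleftrightarrow> ?f x * y = y * ?f x" for y
        using f_mult ff by metis
      then show ?thesis unfolding centralizer_def by auto
    qed
    then show ?thesis unfolding C mem[symmetric] by blast
  qed
  ultimately show ?thesis
    unfolding is_inseparable_subalgebra_def using m f_sub[OF sub] dim gen unfolding fdim_def by metis
qed

text \<open>Three distinct indices are available from degree 8 on. If conjugation by
  \<open>1 + r\<close> preserved \<open>S\<close>, commutators with \<open>u j\<close> and then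
  \<open>u k\<close> would strip \<open>v j\<close> and \<open>v k\<close> from \<open>r\<close> and
  force \<open>s * v m * s = 0\<close>.\<close>

lemma isotropic_two_inseparable:
  assumes n: "n \<ge> 3" and iso: "\<not> anisotropic \<sigma>"
  obtains S' where "is_inseparable_subalgebra scl \<sigma> S'" "S' \<noteq> S"
proof -
  obtain s0 where "s0 \<in> S" "s0 * s0 = 0" "s0 \<noteq> 0"
    using iso anisotropic_iff_reduced by blast
  then obtain m s where m: "m < n" and s: "s \<in> S" "s * s = 0" "s * v m * s \<noteq> 0"
    by (rule ex_square_zero_moved)
  have "\<exists>j k. j < n \<and> k < n \<and> j \<noteq> m \<and> k \<noteq> m \<and> j \<noteq> k"
  proof -
    consider "m = 0" | "m = 1" | "m \<ge> 2" by linarith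
    then show ?thesis
    proof cases
      case 1
      then show ?thesis using n by (intro exI[of _ 1] exI[of _ 2]) auto
    next
      case 2
      then show ?thesis using n by (intro exI[of _ 0] exI[of _ 2]) auto
    next
      case 3
      then show ?thesis using n by (intro exI[of _ 0] exI[of _ 1]) auto
    qed
  qed
  then obtain j k where jk: "j < n" "k < n" "j \<noteq> m" "k \<noteq> m" "j \<noteq> k" by blast
  define w where "w = v m * v j * v k"
  define r where "r = s * w * s"
  define g where "g = 1 + r"
  have ss: "s * (s * x) = 0" for x using s(2) by (simp flip: mult.assoc)
  have "\<sigma> w = v k * (v j * v m)"
    unfolding w_def by (simp add: sigma_mult sigma_v m jk mult.assoc)
  also have "\<dots> = w"
    unfolding w_def
    by (simp add: v_v[OF jk(1) m] v_v[OF jk(2) jk(1)] commute_left[OF v_v[OF jk(2) m]] mult.assoc)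
  finally have "\<sigma> r = r"
    unfolding r_def by (simp add: sigma_mult sigma_S[OF s(1)] mult.assoc)
  then have sg: "\<sigma> g = g" unfolding g_def by (simp add: sigma_add)
  have "r * r = 0" unfolding r_def by (simp add: mult.assoc ss)
  then have gg: "g * g = 1" unfolding g_def by (simp add: algebra_simps)
  let ?S' = "(\<lambda>x. g * x * g) ` S"
  have "is_inseparable_subalgebra scl \<sigma> ?S'"
    by (rule inseparable_conj[OF gg sg inseparable_S])
  moreover have "?S' \<noteq> S"
  proof
    assume eq: "?S' = S"
    have su: "s * u i = u i * s" if "i < n" for i using S_commute s(1) u_in_S[OF that] by blast
    \<comment> \<open>This makes conjugation by \<open>g\<close> add just the commutator
      \<open>y\<close> to \<open>u j\<close>, so \<open>y\<close> would lie in
      \<open>S\<close>.\<close>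
    have "r * u j * r = 0"
    proof -
      have "r * u j * r = s * w * (s * u j) * s * w * s" unfolding r_def by (simp add: mult.assoc)
      then show ?thesis by (simp add: su[OF jk(1)] mult.assoc ss)
    qed
    define y where "y = r * u j + u j * r"
    have "g * u j * g = u j + y"
      unfolding g_def y_def using \<open>r * u j * r = 0\<close> by (simp add: algebra_simps)
    moreover have "g * u j * g \<in> S" using eq u_in_S[OF jk(1)] by blast
    ultimately have "u j + y \<in> S" by simp
    then have "u j + (u j + y) \<in> S" by (rule S_closed(3)[OF u_in_S[OF jk(1)]])
    then have yS: "y \<in> S" by simp
    have wu: "w * u j + u j * w = v m * u j * v k"
    proof -
      have "w * u j = v m * (v j * u j) * v k"
        unfolding w_def using u_v_comm[OF jk(1,2,5)] by (simp add: mult.assoc)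
      moreover have "u j * w = v m * (u j * v j) * v k"
        unfolding w_def using u_v_comm[OF jk(1) m jk(3)] by (simp flip: mult.assoc)
      moreover have "v m * (v j * u j) * v k + v m * (u j * v j) * v k = v m * (u j * v j + v j * u j) * v k"
        by (simp add: algebra_simps)
      ultimately show ?thesis using u_v[OF jk(1)] by simp
    qed
    have "y = s * (w * u j + u j * w) * s"
    proof -
      have "r * u j = s * (w * u j) * s" unfolding r_def by (simp add: mult.assoc su[OF jk(1)])
      moreover have "u j * r = s * (u j * w) * s"
        unfolding r_def by (simp flip: mult.assoc add: su[OF jk(1)])
      ultimately show ?thesis unfolding y_def by (simp add: algebra_simps)
    qed
    then have y_eq: "y = s * (v m * u j) * v k * s" unfolding wu by (simp add: mult.assoc)
    have vu: "u k * (v m * u j) = v m * u j * u k"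
      using u_v_comm[OF jk(2) m jk(4)] u_u[OF jk(2,1)] by (metis mult.assoc)
    have "y * u k + u k * y = s * (v m * u j) * (u k * v k + v k * u k) * s"
    proof -
      have "y * u k = s * (v m * u j) * (v k * u k) * s"
        unfolding y_eq by (simp add: mult.assoc su[OF jk(2)])
      moreover have "u k * y = s * (u k * (v m * u j)) * v k * s"
        unfolding y_eq by (simp flip: mult.assoc add: su[OF jk(2)])
      ultimately show ?thesis unfolding vu by (simp add: algebra_simps)
    qed
    \<comment> \<open>Membership of \<open>y\<close> in the commutative \<open>S\<close> is what
      makes this second commutator vanish.\<close>
    moreover have "y * u k + u k * y = 0" using S_commute[OF yS u_in_S[OF jk(2)]] by simp
    ultimately have "s * (v m * u j) * u k * s = 0" using u_v[OF jk(2)] by simp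
    moreover have "s * (v m * u j) * u k * s = s * v m * s * u j * u k"
      by (simp add: mult.assoc su[OF jk(1), symmetric] su[OF jk(2), symmetric]
          commute_left[OF su[OF jk(1)], symmetric] commute_left[OF su[OF jk(2)], symmetric])
    ultimately have "s * v m * s = 0" using u_cancel jk(1,2) by metis
    then show False using s(3) by simp
  qed
  ultimately show ?thesis by (rule that)
qed

lemma unique_inseparable_iff:
  "(\<exists>!S'. is_inseparable_subalgebra scl \<sigma> S') \<longleftrightarrow> n \<le> 2 \<or> anisotropic \<sigma>"
proof
  assume "\<exists>!S'. is_inseparable_subalgebra scl \<sigma> S'"
  then show "n \<le> 2 \<or> anisotropic \<sigma>"
    using isotropic_two_inseparable inseparable_S by (metis not_less_eq_eq numeral_2_eq_2 numeral_3_eq_3)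
next
  assume cond: "n \<le> 2 \<or> anisotropic \<sigma>"
  \<comment> \<open>Inclusion suffices, because \<open>inseparable_subset_S\<close> turns it into
    equality.\<close>
  have "S' \<subseteq> S" if S': "is_inseparable_subalgebra scl \<sigma> S'" for S'
  proof -
    obtain m h where m: "alg_degree scl = 2 ^ m" and sub: "is_subalgebra scl S'"
      and dim: "fdim scl S' = 2 ^ m" and Sp: "S' \<subseteq> Sym_plus scl \<sigma>" and C: "centralizer S' = S'"
      and h: "S' = subalg_gen scl (h ` {..<m})"
      using S' unfolding is_inseparable_subalgebra_def by blast
    have "m = n" using m alg_degree_eq by simp
    consider "n = 0" | "n = 1" | "n = 2" | "anisotropic \<sigma>" using cond by linarith
    then show "S' \<subseteq> S"
    proof cases
      case 1
      \<comment> \<open>Here both subalgebras are generated by the empty set.\<close>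
      then show ?thesis using h \<open>m = n\<close> S_def by simp
    next
      case 2
      then show ?thesis using Sp Sym_plus_subset_degree_2 by blast
    next
      case 3
      have "h ` {..<2} = {h 0, h 1}" by (auto simp: numeral_2_eq_2 less_Suc_eq)
      then have gen: "S' = subalg_gen scl {h 0, h 1}" using h \<open>m = n\<close> 3 by simp
      then have hS: "h 0 \<in> S'" "h 1 \<in> S'" using gen_base[of _ "{h 0, h 1}"] by auto
      then have comm: "h 0 * h 1 = h 1 * h 0" using C unfolding centralizer_def by blast
      have cent: "S' = centralizer {h 0, h 1}" using C gen centralizer_gen by metis
      then have cent': "S' = centralizer {h 1, h 0}" by (simp add: insert_commute)
      have d: "dim S' = 4" using dim \<open>m = n\<close> 3 unfolding fdim_def by simp
      have "h 0 \<in> S"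
        by (rule inseparable_degree_4_subset[OF 3 _ _ comm cent d Sp]) (use hS Sp in auto)
      moreover have "h 1 \<in> S"
        by (rule inseparable_degree_4_subset[OF 3 _ _ comm[symmetric] cent' d Sp]) (use hS Sp in auto)
      ultimately show ?thesis unfolding gen by (intro gen_minimal[OF subalgebra_S]) auto
    next
      case 4
      then show ?thesis using Sp anisotropic_Sym_plus_subset by blast
    qed
  qed
  then show "\<exists>!S'. is_inseparable_subalgebra scl \<sigma> S'"
    using inseparable_S inseparable_subset_S by blast
qed

end

section \<open>From a totally decomposable involution to generators of its factors\<close>

theorem theorem3p10:
  fixes scl :: "'f::field \<Rightarrow> 'a::ring_1 \<Rightarrow> 'a" and \<sigma> :: "'a \<Rightarrow> 'a"
  assumes "(1::'f) + 1 = 0"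
    and "is_CSA scl"
    and "is_involution_1st scl \<sigma>"
    and "is_orthogonal_char2 \<sigma>"
    and "totally_decomposable scl \<sigma>"
  shows "(\<exists>!S. is_inseparable_subalgebra scl \<sigma> S) \<longleftrightarrow>
           (alg_degree scl \<le> 4 \<or> anisotropic \<sigma>)"
proof -
  have alg: "is_F_algebra scl" and csa: "central_simple_on scl UNIV"
    using assms(2) unfolding is_CSA_def by auto
  interpret vs: vector_space scl using alg unfolding is_F_algebra_def by blast
  obtain B0 where B0: "finite B0" "vs.span B0 = UNIV"
    using csa unfolding central_simple_on_def fin_dim_on_def by blast
  \<comment> \<open>A basis inside the finite spanning set supplies the finite \<open>Basis\<close>
    of the locale.\<close>
  obtain B where B: "B \<subseteq> B0" "vs.independent B" "B0 \<subseteq> vs.span B"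
    using vs.maximal_independent_subset[of B0] by blast
  have "vs.span B0 \<subseteq> vs.span B" using B(3) by (intro vs.span_minimal) auto
  then have spanB: "vs.span B = UNIV" using B0(2) by auto
  interpret char2_involution scl B \<sigma>
  proof unfold_locales
    show "finite B" using B(1) B0(1) by (rule finite_subset)
    show "1 + 1 = (0::'f)" by (rule assms(1))
    show "1 \<notin> Alt \<sigma>" using assms(4) unfolding is_orthogonal_char2_def .
    show "scl c (x * y) = scl c x * y" "scl c (x * y) = x * scl c y" for c x y
      using alg unfolding is_F_algebra_def by blast+
  qed (use assms(3) B(2) spanB in \<open>auto simp: is_involution_1st_def\<close>)
  obtain n :: nat and Q where
    QS: "\<forall>i<n. is_quaternion_subalgebra scl (Q i) \<and> \<sigma> ` Q i \<subseteq> Q i" and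
    comm_Q: "\<forall>i<n. \<forall>j<n. i \<noteq> j \<longrightarrow> (\<forall>x\<in>Q i. \<forall>y\<in>Q j. x * y = y * x)" and
    gen: "subalg_gen scl (\<Union>i<n. Q i) = UNIV"
    using assms(5) unfolding totally_decomposable_def by (elim exE conjE)
  have Q: "is_quaternion_subalgebra scl (Q i)" and stable: "\<sigma> ` Q i \<subseteq> Q i" if "i < n" for i
    using QS that by simp_all
  have comm: "x * y = y * x" if "i < n" "j < n" "i \<noteq> j" "x \<in> Q i" "y \<in> Q j" for i j x y
    by (rule comm_Q[rule_format, OF that])
  have "\<exists>u v a c. u \<in> Q i \<and> v \<in> Q i \<and> a \<noteq> 0 \<and> u * u = scl a 1 \<and> v * v = v + scl c 1 \<and>
      u * v + v * u = u \<and> \<sigma> u = u \<and> \<sigma> v = v \<and> subalg_gen scl {u, v} = Q i" if "i < n" for i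
    using quaternion_generators[OF Q[OF that] stable[OF that]] by metis
  then obtain u v a c where uv: "\<And>i. i < n \<Longrightarrow> u i \<in> Q i \<and> v i \<in> Q i \<and> a i \<noteq> 0 \<and>
      u i * u i = scl (a i) 1 \<and> v i * v i = v i + scl (c i) 1 \<and> u i * v i + v i * u i = u i \<and>
      \<sigma> (u i) = u i \<and> \<sigma> (v i) = v i \<and> subalg_gen scl {u i, v i} = Q i"
    by metis
  interpret quaternion_decomposition scl B \<sigma> n u v a c
  proof unfold_locales
    have "centre_on UNIV = scalars scl" using csa unfolding central_simple_on_def by blast
    then show "centralizer UNIV \<subseteq> scalars scl" unfolding centralizer_def centre_on_def by auto
    have "Q i \<subseteq> subalg_gen scl (u ` {..<n} \<union> v ` {..<n})" if "i < n" for i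
    proof -
      have "Q i = subalg_gen scl {u i, v i}" using uv[OF that] by simp
      also have "\<dots> \<subseteq> subalg_gen scl (u ` {..<n} \<union> v ` {..<n})"
        by (rule gen_mono) (use that in auto)
      finally show ?thesis .
    qed
    then have "subalg_gen scl (\<Union>i<n. Q i) \<subseteq> subalg_gen scl (u ` {..<n} \<union> v ` {..<n})"
      by (intro gen_minimal[OF subalgebra_gen]) auto
    then show "subalg_gen scl (u ` {..<n} \<union> v ` {..<n}) = UNIV" using gen by auto
    fix i j assume ij: "i < n" "j < n"
    show "u i * u j = u j * u i" "v i * v j = v j * v i"
      using comm[OF ij] uv[OF ij(1)] uv[OF ij(2)] by (cases "i = j"; blast)+
    show "u i * v j = v j * u i" if "i \<noteq> j"
      using comm[OF ij that] uv[OF ij(1)] uv[OF ij(2)] by blast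
  qed (use uv in blast)+
  have "alg_degree scl \<le> 4 \<longleftrightarrow> (2::nat) ^ n \<le> 2 ^ 2" unfolding alg_degree_eq by simp
  also have "\<dots> \<longleftrightarrow> n \<le> 2" by (rule power_increasing_iff) simp
  finally show ?thesis using unique_inseparable_iff by blast
qed

end
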